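(* Let $\mathcal{X}\subseteq\mathbb{R}^d$, let $\nu$ be a probability measure with support $\mathcal{X}$, let $k:\mathcal{X}\times\mathcal{X}\to\mathbb{R}$ be a kernel, let $r:\mathcal{X}\to\mathbb{R}_{\ge 0}$ be a noise variance function, and let $M\ge 1$ be the sample size. Assume: 1. $k$ is bounded and positive-definite on $\mathcal{X}$. 2. The observation points $X=[x_1,\ldots,x_N]^\top$ are sampled (independently) from the known probability measure $\nu$. 3. The data set $\overline U=[\overline u(x_1),\ldots,\overline u(x_N)]^\top$ satisfies $p(\overline U\mid v_X,X)=\mathcal{N}\left(v_X,\tfrac{1}{M}r_{XX}\right)$, where $v_X=[v(0,x_1),\ldots,v(0,x_N)]^\top$. 4. $r$ attains a positive minimum value $r_{\min}=\min_{x\in\mathcal{X}}r(x)>0$. Then for any $\epsilon>0$ there exists an integer $\widetilde N(\epsilon)>0$ such that for any $N>\widetilde N(\epsilon)$, $$\mathrm{Pr}\left(\mathrm{IMSE}>(1-\epsilon)\,L_{\mathrm{IMSE}}\right)=1,$$ where $$L_{\mathrm{IMSE}}:=r_{\min}\sum_{p\in I}\frac{\lambda_p}{r_{\min}+NM\lambda_p},$$ $\{\lambda_p\}_{p\in I}$ are the eigenvalues of the kernel $k$ for the probability measure $\nu$, and $I\subseteq\mathbb{N}$ is their index set.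
   Context: PDE setting. $v:[0,T]\times\mathbb{R}^d\to\mathbb{R}$ is the (unique viscosity) solution of the Kolmogorov PDE $\partial_t v+\frac12\operatorname{tr}\{a a^\top\partial_{xx}v\}+b^\top\partial_x v+c\,v+h=0$ on $[0,T)\times\mathbb{R}^d$, $v(T,x)=g(x)$, where $T>0$, $b:[0,T]\times\mathbb{R}^d\to\mathbb{R}^d$, $a:[0,T]\times\mathbb{R}^d\to\mathbb{R}^{d\times m}$, $c,h:[0,T]\times\mathbb{R}^d\to\mathbb{R}$, $g:\mathbb{R}^d\to\mathbb{R}$. The functions $a,b,c,h$ are uniformly continuous, $c$ is bounded, and there is $L>0$ such that each $\varphi\in\{a,b,c,h\}$ satisfies $|\varphi(t,x)-\varphi(t,x')|\le L|x-x'|$ and $|\varphi(t,0)|\le L$ for all $t\in[0,T]$, $x,x'\in\mathbb{R}^d$. Gaussian process regression. $v(0,\cdot)$ is given the prior $p(v_X\mid X)=\mathcal{N}(0,k_{XX})$ for every $X\in\mathcal{X}^N$, where $[k_{XX}]_{ij}=k(x_i,x_j)$. Here $k$ is called positive-definite if $\sum_{i,j=1}^n c_ic_jk(y_i,y_j)\ge 0$ for all $n\in\mathbb{N}$, $c\in\mathbb{R}^n$, $y_1,\ldots,y_n\in\mathcal{X}$. At each observation point $x_i$ one has $M$ observations $u_j(x_i)=v(0,x_i)+\xi_{i,j}$ ($1\le i\le N$, $1\le j\le M$), with $\xi_{i,j}\sim\mathcal{N}(0,r(x_i))$ independent, and $\overline u(x_i)=\frac1M\sum_{j=1}^M u_j(x_i)$.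 The noise variance matrix $r_{XX}\in\mathbb{R}^{N\times N}$ is $[r_{XX}]_{ij}=\delta_{ij}r(x_i)$. Put $k_{Xx}=k_{xX}^\top=[k(x_1,x),\ldots,k(x_N,x)]^\top$. The posterior variance is $$\widetilde\sigma^2(x)=k(x,x)-k_{xX}\left(k_{XX}+\tfrac{1}{M}r_{XX}\right)^{-1}k_{Xx},\quad x\in\mathcal{X},$$ and $\mathrm{IMSE}:=\int_{\mathcal{X}}\widetilde\sigma^2(x)\,d\nu(x)$, which is random through the observation points $X$. Eigenvalues. The eigenvalues of $k$ for $\nu$ are the positive eigenvalues $\lambda_1\ge\lambda_2\ge\cdots>0$ (counted with multiplicity) of the integral operator $T_k:L_2(\nu)\to L_2(\nu)$, $T_kf=\int k(\cdot,x)f(x)\,d\nu(x)$. The index set is $I=\mathbb{N}$ if the reproducing kernel Hilbert space is infinite dimensional and $I=\{1,\ldots,K\}$ if it is $K$-dimensional. The kernel is represented by its Mercer expansion $k(x,x')=\sum_{i\in I}\lambda_i\phi_i(x)\phi_i(x')$, where $\{\phi_i\}_{i\in I}$ are the corresponding eigenfunctions, orthonormal in $L_2(\nu)$.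
   Formalization: A deterministic Ñ(ε) with probability 1 fails for nonconstant eigenfunctions; proved instead: for one infinite i.i.d. sequence x_1, x_2, …, almost surely there is Ñ(ε), depending on the realization, with IMSE > (1−ε)L_IMSE for all N > Ñ(ε). The index set I is assumed nonempty. *)

theory Defs
  imports
    "HOL-Probability.Probability"
    "Jordan_Normal_Form.Gauss_Jordan_Elimination"
begin

(* Functions given on a subset S of the space are total HOL functions here, and every notion
   below depends on their values on S only. *)

section \<open>The Kolmogorov equation\<close>

definition regular_coefficient ::
    "real \<Rightarrow> real \<Rightarrow> (real \<Rightarrow> 'a::real_normed_vector \<Rightarrow> 'b::real_normed_vector) \<Rightarrow> bool" where
  "regular_coefficient T L f \<longleftrightarrow>
     uniformly_continuous_on ({0..T} \<times> UNIV) (\<lambda>(t, x). f t x) \<and>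
     (\<forall>t\<in>{0..T}. \<forall>x x'. norm (f t x - f t x') \<le> L * norm (x - x')) \<and>
     (\<forall>t\<in>{0..T}. norm (f t 0) \<le> L)"

(* \<psi> is of class C^{1,2} on [0,T] x R^d, with time derivative D, gradient G and Hessian H. *)
definition C12_test_function ::
    "real \<Rightarrow> (real \<Rightarrow> real ^ 'd \<Rightarrow> real) \<Rightarrow> (real \<Rightarrow> real ^ 'd \<Rightarrow> real) \<Rightarrow>
     (real \<Rightarrow> real ^ 'd \<Rightarrow> real ^ 'd) \<Rightarrow> (real \<Rightarrow> real ^ 'd \<Rightarrow> real ^ 'd ^ 'd) \<Rightarrow> bool" where
  "C12_test_function T \<psi> D G H \<longleftrightarrow>
     (\<forall>t\<in>{0..T}. \<forall>x.
        ((\<lambda>s. \<psi> s x) has_real_derivative D t x) (at t within {0..T}) \<and>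
        (\<psi> t has_derivative inner (G t x)) (at x) \<and>
        (G t has_derivative matrix_vector_mult (H t x)) (at x)) \<and>
     continuous_on ({0..T} \<times> UNIV) (\<lambda>(t, x). \<psi> t x) \<and>
     continuous_on ({0..T} \<times> UNIV) (\<lambda>(t, x). D t x) \<and>
     continuous_on ({0..T} \<times> UNIV) (\<lambda>(t, x). G t x) \<and>
     continuous_on ({0..T} \<times> UNIV) (\<lambda>(t, x). H t x)"

definition local_max_at ::
    "real \<Rightarrow> (real \<Rightarrow> real ^ 'd \<Rightarrow> real) \<Rightarrow> real \<Rightarrow> real ^ 'd \<Rightarrow> bool" where
  "local_max_at T w t x \<longleftrightarrow>
     (\<exists>e>0. \<forall>s\<in>{0..T}. \<forall>y. dist (s, y) (t, x) < e \<longrightarrow> w s y \<le> w t x)"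

definition kolmogorov_operator ::
    "(real \<Rightarrow> real ^ 'd \<Rightarrow> real ^ 'm ^ 'd) \<Rightarrow> (real \<Rightarrow> real ^ 'd \<Rightarrow> real ^ 'd) \<Rightarrow>
     (real \<Rightarrow> real ^ 'd \<Rightarrow> real) \<Rightarrow> (real \<Rightarrow> real ^ 'd \<Rightarrow> real) \<Rightarrow>
     real \<Rightarrow> real ^ 'd \<Rightarrow> real \<Rightarrow> real \<Rightarrow> real ^ 'd \<Rightarrow> real ^ 'd ^ 'd \<Rightarrow> real" where
  "kolmogorov_operator a b c h t x z D G H =
     D + Determinants.trace (a t x ** Finite_Cartesian_Product.transpose (a t x) ** H) / 2
       + inner (b t x) G + c t x * z + h t x"

(* The equation is backward in time, so a subsolution satisfies "\<ge> 0" at a maximum. *)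
definition viscosity_solution ::
    "real \<Rightarrow> (real \<Rightarrow> real ^ 'd \<Rightarrow> real ^ 'm ^ 'd) \<Rightarrow> (real \<Rightarrow> real ^ 'd \<Rightarrow> real ^ 'd) \<Rightarrow>
     (real \<Rightarrow> real ^ 'd \<Rightarrow> real) \<Rightarrow> (real \<Rightarrow> real ^ 'd \<Rightarrow> real) \<Rightarrow> (real ^ 'd \<Rightarrow> real) \<Rightarrow>
     (real \<Rightarrow> real ^ 'd \<Rightarrow> real) \<Rightarrow> bool" where
  "viscosity_solution T a b c h g v \<longleftrightarrow>
     continuous_on ({0..T} \<times> UNIV) (\<lambda>(t, x). v t x) \<and>
     (\<forall>x. v T x = g x) \<and>
     (\<forall>\<psi> D G H t x. C12_test_function T \<psi> D G H \<longrightarrow> t \<in> {0..<T} \<longrightarrow>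
        (local_max_at T (\<lambda>s y. v s y - \<psi> s y) t x \<longrightarrow>
           0 \<le> kolmogorov_operator a b c h t x (v t x) (D t x) (G t x) (H t x)) \<and>
        (local_max_at T (\<lambda>s y. \<psi> s y - v s y) t x \<longrightarrow>
           kolmogorov_operator a b c h t x (v t x) (D t x) (G t x) (H t x) \<le> 0))"


section \<open>Kernels, their eigenvalues and their reproducing kernel Hilbert spaces\<close>

definition support_of :: "'a::topological_space measure \<Rightarrow> 'a set" where
  "support_of \<nu> = {x. \<forall>U. open U \<and> x \<in> U \<longrightarrow> emeasure \<nu> U > 0}"

definition positive_definite_on :: "'a set \<Rightarrow> ('a \<Rightarrow> 'a \<Rightarrow> real) \<Rightarrow> bool" where
  "positive_definite_on S k \<longleftrightarrow>
     (\<forall>(n::nat) (c::nat \<Rightarrow> real) y. (\<forall>i<n. y i \<in> S) \<longrightarrow>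
        0 \<le> (\<Sum>i<n. \<Sum>j<n. c i * c j * k (y i) (y j)))"

definition L2_on :: "'a measure \<Rightarrow> 'a set \<Rightarrow> ('a \<Rightarrow> real) set" where
  "L2_on \<nu> S = {f. set_borel_measurable \<nu> S f \<and> set_integrable \<nu> S (\<lambda>x. (f x)\<^sup>2)}"

definition integral_operator ::
    "'a measure \<Rightarrow> 'a set \<Rightarrow> ('a \<Rightarrow> 'a \<Rightarrow> real) \<Rightarrow> ('a \<Rightarrow> real) \<Rightarrow> 'a \<Rightarrow> real" where
  "integral_operator \<nu> S k f x = (LINT y:S|\<nu>. k x y * f y)"

definition eigenfunction_for ::
    "'a measure \<Rightarrow> 'a set \<Rightarrow> ('a \<Rightarrow> 'a \<Rightarrow> real) \<Rightarrow> real \<Rightarrow> ('a \<Rightarrow> real) \<Rightarrow> bool" where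
  "eigenfunction_for \<nu> S k \<mu> f \<longleftrightarrow>
     f \<in> L2_on \<nu> S \<and> (AE x in \<nu>. x \<in> S \<longrightarrow> integral_operator \<nu> S k f x = \<mu> * f x)"

(* The last clause says that no positive eigenvalue is missing and that each one occurs as
   often as its multiplicity: the \<phi> i with lam i = \<mu> are a basis of the eigenspace of \<mu>. *)
definition positive_eigensystem ::
    "'a measure \<Rightarrow> 'a set \<Rightarrow> ('a \<Rightarrow> 'a \<Rightarrow> real) \<Rightarrow> nat set \<Rightarrow> (nat \<Rightarrow> real) \<Rightarrow>
     (nat \<Rightarrow> 'a \<Rightarrow> real) \<Rightarrow> bool" where
  "positive_eigensystem \<nu> S k I lam \<phi> \<longleftrightarrow>
     (\<forall>i\<in>I. lam i > 0) \<and>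
     (\<forall>i\<in>I. \<forall>j\<in>I. i \<le> j \<longrightarrow> lam j \<le> lam i) \<and>
     (\<forall>i\<in>I. eigenfunction_for \<nu> S k (lam i) (\<phi> i)) \<and>
     (\<forall>i\<in>I. \<forall>j\<in>I. (LINT x:S|\<nu>. \<phi> i x * \<phi> j x) = (if i = j then 1 else 0)) \<and>
     (\<forall>\<mu>>0. finite {i\<in>I. lam i = \<mu>} \<and>
        (\<forall>f. eigenfunction_for \<nu> S k \<mu> f \<longrightarrow>
           (\<exists>c. AE x in \<nu>. x \<in> S \<longrightarrow> f x = (\<Sum>i | i \<in> I \<and> lam i = \<mu>. c i * \<phi> i x))))"

definition mercer_expansion ::
    "'a set \<Rightarrow> ('a \<Rightarrow> 'a \<Rightarrow> real) \<Rightarrow> nat set \<Rightarrow> (nat \<Rightarrow> real) \<Rightarrow> (nat \<Rightarrow> 'a \<Rightarrow> real) \<Rightarrow> bool" where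
  "mercer_expansion S k I lam \<phi> \<longleftrightarrow>
     (\<forall>x\<in>S. \<forall>x'\<in>S. ((\<lambda>i. lam i * \<phi> i x * \<phi> i x') has_sum k x x') I)"

(* Functions on S are represented by the elements of "extensional S", so that equality of
   elements of H is equality on S. *)
definition reproducing_kernel_hilbert_space ::
    "'a set \<Rightarrow> ('a \<Rightarrow> 'a \<Rightarrow> real) \<Rightarrow> ('a \<Rightarrow> real) set \<Rightarrow>
     (('a \<Rightarrow> real) \<Rightarrow> ('a \<Rightarrow> real) \<Rightarrow> real) \<Rightarrow> bool" where
  "reproducing_kernel_hilbert_space S k H ip \<longleftrightarrow>
     H \<subseteq> extensional S \<and>
     (\<lambda>x\<in>S. 0) \<in> H \<and>
     (\<forall>f\<in>H. \<forall>g\<in>H. \<forall>\<alpha> \<beta>. (\<lambda>x\<in>S. \<alpha> * f x + \<beta> * g x) \<in> H) \<and>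
     (\<forall>f\<in>H. \<forall>g\<in>H. ip f g = ip g f) \<and>
     (\<forall>f\<in>H. \<forall>g\<in>H. \<forall>e\<in>H. \<forall>\<alpha> \<beta>.
        ip (\<lambda>x\<in>S. \<alpha> * f x + \<beta> * g x) e = \<alpha> * ip f e + \<beta> * ip g e) \<and>
     (\<forall>f\<in>H. 0 \<le> ip f f \<and> (ip f f = 0 \<longrightarrow> f = (\<lambda>x\<in>S. 0))) \<and>
     (\<forall>F. (\<forall>n::nat. F n \<in> H) \<longrightarrow>
        (\<forall>e>0. \<exists>n0. \<forall>m\<ge>n0. \<forall>n\<ge>n0.
           sqrt (ip (\<lambda>x\<in>S. F m x - F n x) (\<lambda>x\<in>S. F m x - F n x)) < e) \<longrightarrow>
        (\<exists>f\<in>H. (\<lambda>n. sqrt (ip (\<lambda>x\<in>S. F n x - f x) (\<lambda>x\<in>S. F n x - f x))) \<longlonglongrightarrow> 0)) \<and>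
     (\<forall>x\<in>S. (\<lambda>y\<in>S. k y x) \<in> H \<and> (\<forall>f\<in>H. f x = ip f (\<lambda>y\<in>S. k y x)))"

definition function_space_dim :: "'a set \<Rightarrow> ('a \<Rightarrow> real) set \<Rightarrow> nat \<Rightarrow> bool" where
  "function_space_dim S H K \<longleftrightarrow>
     (\<exists>B. (\<forall>i\<in>{1..K}. B i \<in> H) \<and>
        (\<forall>f\<in>H. \<exists>!c. c \<in> {1..K} \<rightarrow>\<^sub>E (UNIV :: real set) \<and>
           (\<forall>x\<in>S. f x = (\<Sum>i=1..K. c i * B i x))))"

definition eigenvalue_index_set :: "'a set \<Rightarrow> ('a \<Rightarrow> real) set \<Rightarrow> nat set \<Rightarrow> bool" where
  "eigenvalue_index_set S H I \<longleftrightarrow>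
     (\<forall>K. function_space_dim S H K \<longrightarrow> I = {1..K}) \<and>
     ((\<nexists>K. function_space_dim S H K) \<longrightarrow> I = {1..})"


section \<open>Observations\<close>

(* The observation points xs i, the noise and the data are random variables on the probability
   space P. A conditional law given the observation points X = (xs 0, ..., xs (N - 1)) is stated
   through its density: the joint law has this density with respect to the product of the law of
   X and Lebesgue measure. The covariance matrices are diagonal, so the Gaussian densities are
   products of one-dimensional ones. *)

definition gaussian_noise ::
    "'w measure \<Rightarrow> 'a measure \<Rightarrow> ('a \<Rightarrow> real) \<Rightarrow> nat \<Rightarrow> (nat \<Rightarrow> 'w \<Rightarrow> 'a) \<Rightarrow>
     (nat \<Rightarrow> nat \<Rightarrow> 'w \<Rightarrow> real) \<Rightarrow> nat \<Rightarrow> bool" where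
  "gaussian_noise P \<nu> r M xs \<xi> N \<longleftrightarrow>
     distr P (PiM {..<N} (\<lambda>_. \<nu>) \<Otimes>\<^sub>M PiM ({..<N} \<times> {..<M}) (\<lambda>_. lborel))
       (\<lambda>\<omega>. (\<lambda>i\<in>{..<N}. xs i \<omega>, \<lambda>(i, j)\<in>{..<N} \<times> {..<M}. \<xi> i j \<omega>))
     = density (PiM {..<N} (\<lambda>_. \<nu>) \<Otimes>\<^sub>M PiM ({..<N} \<times> {..<M}) (\<lambda>_. lborel))
         (\<lambda>(X, E). ennreal (\<Prod>i<N. \<Prod>j<M. normal_density 0 (sqrt (r (X i))) (E (i, j))))"

definition sample_mean ::
    "nat \<Rightarrow> (nat \<Rightarrow> nat \<Rightarrow> 'w \<Rightarrow> real) \<Rightarrow> nat \<Rightarrow> 'w \<Rightarrow> real" where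
  "sample_mean M u i \<omega> = (\<Sum>j<M. u i j \<omega>) / real M"

(* The observed function is f; in the application f = v(0, .). *)
definition gaussian_data ::
    "'w measure \<Rightarrow> 'a measure \<Rightarrow> ('a \<Rightarrow> real) \<Rightarrow> nat \<Rightarrow> ('a \<Rightarrow> real) \<Rightarrow> (nat \<Rightarrow> 'w \<Rightarrow> 'a) \<Rightarrow>
     (nat \<Rightarrow> 'w \<Rightarrow> real) \<Rightarrow> nat \<Rightarrow> bool" where
  "gaussian_data P \<nu> r M f xs U N \<longleftrightarrow>
     distr P (PiM {..<N} (\<lambda>_. \<nu>) \<Otimes>\<^sub>M PiM {..<N} (\<lambda>_. lborel))
       (\<lambda>\<omega>. (\<lambda>i\<in>{..<N}. xs i \<omega>, \<lambda>i\<in>{..<N}. U i \<omega>))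
     = density (PiM {..<N} (\<lambda>_. \<nu>) \<Otimes>\<^sub>M PiM {..<N} (\<lambda>_. lborel))
         (\<lambda>(X, Y). ennreal (\<Prod>i<N. normal_density (f (X i)) (sqrt (r (X i) / real M)) (Y i)))"


section \<open>Posterior variance and integrated mean squared error\<close>

definition gram_matrix :: "('a \<Rightarrow> 'a \<Rightarrow> real) \<Rightarrow> nat \<Rightarrow> (nat \<Rightarrow> 'a) \<Rightarrow> real Matrix.mat" where
  "gram_matrix k N X = Matrix.mat N N (\<lambda>(i, j). k (X i) (X j))"

definition noise_matrix :: "('a \<Rightarrow> real) \<Rightarrow> nat \<Rightarrow> (nat \<Rightarrow> 'a) \<Rightarrow> real Matrix.mat" where
  "noise_matrix r N X = Matrix.mat N N (\<lambda>(i, j). if i = j then r (X i) else 0)"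

definition kernel_vector ::
    "('a \<Rightarrow> 'a \<Rightarrow> real) \<Rightarrow> nat \<Rightarrow> (nat \<Rightarrow> 'a) \<Rightarrow> 'a \<Rightarrow> real Matrix.vec" where
  "kernel_vector k N X x = Matrix.vec N (\<lambda>i. k (X i) x)"

(* The matrix is invertible as soon as k is positive-definite and r is positive at the points
   X i, so the inverse is meaningful there. *)
definition posterior_variance ::
    "('a \<Rightarrow> 'a \<Rightarrow> real) \<Rightarrow> ('a \<Rightarrow> real) \<Rightarrow> nat \<Rightarrow> nat \<Rightarrow> (nat \<Rightarrow> 'a) \<Rightarrow> 'a \<Rightarrow> real" where
  "posterior_variance k r M N X x =
     k x x - scalar_prod (kernel_vector k N X x)
       (the (mat_inverse (gram_matrix k N X + (1 / real M) \<cdot>\<^sub>m noise_matrix r N X))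
          *\<^sub>v kernel_vector k N X x)"

definition IMSE ::
    "'a measure \<Rightarrow> 'a set \<Rightarrow> ('a \<Rightarrow> 'a \<Rightarrow> real) \<Rightarrow> ('a \<Rightarrow> real) \<Rightarrow> nat \<Rightarrow> nat \<Rightarrow>
     (nat \<Rightarrow> 'a) \<Rightarrow> real" where
  "IMSE \<nu> S k r M N X = (LINT x:S|\<nu>. posterior_variance k r M N X x)"

definition L_IMSE :: "real \<Rightarrow> nat \<Rightarrow> nat set \<Rightarrow> (nat \<Rightarrow> real) \<Rightarrow> nat \<Rightarrow> real" where
  "L_IMSE rmin M I lam N =
     rmin * (\<Sum>\<^sub>\<infinity>p\<in>I. lam p / (rmin + real N * real M * lam p))"

end

theory Submission
  imports Defs "Jordan_Normal_Form.Determinant"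
begin

text \<open>
  Let \<open>s = rmin / M\<close>, a lower bound for the noise variance of the averaged observations, and
  \<open>S\<^sub>p = (\<Sum>i<N. (\<phi>\<^sub>p(x\<^sub>i))\<^sup>2)\<close>. The claimed bound \<open>L_IMSE\<close> is the sum over \<open>p\<close> of
  \<open>s \<lambda>\<^sub>p / (s + N \<lambda>\<^sub>p)\<close>, and \<open>S\<^sub>p\<close> has mean \<open>N\<close>.

  The deterministic half of the proof is the inequality
  \<open>IMSE \<ge> (\<Sum>p. s \<lambda>\<^sub>p / (s + \<lambda>\<^sub>p S\<^sub>p))\<close>, valid for every choice of observation points
  (\<open>integral_posterior_variance_ge\<close>). By the Mercer expansion and orthonormality, the integrated
  variance is the sum of \<open>\<lambda>\<^sub>p - \<lambda>\<^sub>p\<^sup>2 f\<^sub>p\<^sup>T A\<^sup>-\<^sup>1 f\<^sub>p\<close>, where \<open>A\<close> is the Gram matrix plus noise and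
  \<open>f\<^sub>p\<close> is the eigenfunction evaluated at the observation points; and \<open>A \<ge> s 1 + \<lambda>\<^sub>p f\<^sub>p f\<^sub>p\<^sup>T\<close>
  bounds each of these terms (\<open>posterior_variance_quadratic_form\<close>).

  The probabilistic half has to replace \<open>S\<^sub>p\<close> by \<open>N\<close> up to a factor close to 1. The law of large
  numbers does this for each \<open>p\<close>, but not uniformly over infinitely many modes, whose
  eigenfunctions need not be uniformly bounded. Since \<open>t \<mapsto> 1 / t\<close> is convex, however, it is enough to
  control one weighted combination of the \<open>S\<^sub>p / N\<close>, the empirical mean of the function
  \<open>\<Sum>p. w\<^sub>p\<^sup>2 \<phi>\<^sub>p\<^sup>2\<close> with weights \<open>w\<^sub>p = n \<lambda>\<^sub>p / (s + n \<lambda>\<^sub>p)\<close> (\<open>mode_sum_ge\<close>). If \<open>b\<close> bounds the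
  kernel on the diagonal, this function is bounded by \<open>n b / s\<close>, and its mean is at most the
  effective dimension \<open>d(n) = (\<Sum>p. w\<^sub>p)\<close>. Chebyshev's inequality then bounds the probability that
  its empirical mean over at least \<open>n\<close> points ever exceeds its mean by \<open>\<delta> d(n)\<close> and a further
  factor \<open>1 + \<delta>\<close>: it is at most a constant times \<open>1 / d(n)\<close>
  (\<open>averages_of_nonneg_uniformly_le\<close>).

  The same \<open>n\<close> may be used for all \<open>N \<ge> n\<close> with \<open>d(N) \<le> (1 + \<delta>) d(n)\<close>. If \<open>d\<close> is unbounded, take
  the successive \<open>n\<close> at which \<open>d\<close> passes the powers of \<open>1 + \<delta>\<close>; the failure probabilities are
  summable and the Borel-Cantelli lemma applies. If \<open>d\<close> is bounded, one \<open>n\<close> suffices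
  (\<open>growth_scales\<close>).
\<close>

section \<open>The posterior variance as a quadratic form\<close>

text \<open>
  This is the comparison of inverses \<open>A\<^sup>-\<^sup>1 \<le> (s 1 + l f f\<^sup>T)\<^sup>-\<^sup>1\<close>
  tested on \<open>f\<close>, with \<open>y = A\<^sup>-\<^sup>1 f\<close>: the hypothesis is \<open>s 1 + l f f\<^sup>T \<le> A\<close> tested on \<open>y\<close>,
  and the right-hand side is \<open>f\<^sup>T (s 1 + l f f\<^sup>T)\<^sup>-\<^sup>1 f\<close> by the Sherman-Morrison formula. The
  vector \<open>f / (s + l \<bar>f\<bar>\<^sup>2)\<close> that is subtracted in the proof is \<open>(s 1 + l f f\<^sup>T)\<^sup>-\<^sup>1 f\<close>.
\<close>

lemma sum_product_le_of_quadratic_bound: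
  fixes f y :: "nat \<Rightarrow> real"
  assumes "0 < s" "0 \<le> l"
    and bound: "s * (\<Sum>i<N. (y i)\<^sup>2) + l * (\<Sum>i<N. f i * y i)\<^sup>2 \<le> (\<Sum>i<N. f i * y i)"
  shows "(\<Sum>i<N. f i * y i) \<le> (\<Sum>i<N. (f i)\<^sup>2) / (s + l * (\<Sum>i<N. (f i)\<^sup>2))"
proof -
  define q where "q = (\<Sum>i<N. f i * y i)"
  define F where "F = (\<Sum>i<N. (f i)\<^sup>2)"
  define Y where "Y = (\<Sum>i<N. (y i)\<^sup>2)"
  define D where "D = s + l * F"
  have "0 \<le> F" unfolding F_def by (intro sum_nonneg) auto
  then have D: "0 < D" using assms unfolding D_def by (simp add: add_pos_nonneg)
  define w where "w = 1 / D"
  have Dw: "D * w = 1" using D unfolding w_def by simp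
  have "0 \<le> (\<Sum>i<N. (y i - w * f i)\<^sup>2)" by (intro sum_nonneg) auto
  also have "\<dots> = (\<Sum>i<N. (y i)\<^sup>2 - 2 * w * (f i * y i) + w\<^sup>2 * (f i)\<^sup>2)"
    by (intro sum.cong) (auto simp: power2_diff power_mult_distrib)
  also have "\<dots> = Y - 2 * w * q + w\<^sup>2 * F"
    unfolding Y_def q_def F_def by (simp add: sum.distrib sum_subtractf sum_distrib_left)
  finally have "0 \<le> s * (Y - 2 * w * q + w\<^sup>2 * F)" using assms(1) by simp
  moreover have "0 \<le> l * (q - w * F)\<^sup>2" using assms(2) by simp
  ultimately have "0 \<le> s * (Y - 2 * w * q + w\<^sup>2 * F) + l * (q - w * F)\<^sup>2" by simp
  also have "\<dots> = (s * Y + l * q\<^sup>2) - 2 * q * (D * w) + F * w * (D * w)"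
    unfolding D_def by (simp add: algebra_simps power2_eq_square)
  also have "\<dots> = (s * Y + l * q\<^sup>2) - 2 * q + F * w" unfolding Dw by simp
  also have "\<dots> \<le> F * w - q" using bound unfolding Y_def q_def by simp
  finally show ?thesis unfolding w_def q_def F_def D_def by simp
qed

text \<open>
  \<open>B\<close> is the inverse of the Gram matrix plus noise; it exists because the noise makes the
  quadratic form at least \<open>s \<bar>y\<bar>\<^sup>2\<close>. The second conclusion is all that the lower bound needs to
  know about it: a rank-one part \<open>l f f\<^sup>T\<close> of the Gram matrix limits how large the inverse can be
  in the direction \<open>f\<close>. Here \<open>f\<close> will be an eigenfunction evaluated at the observation points.
\<close>

lemma posterior_variance_quadratic_form:
  assumes psd: "\<And>y. 0 \<le> (\<Sum>i<N. \<Sum>j<N. y i * y j * k (X i) (X j))"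
    and noise: "\<And>i. i < N \<Longrightarrow> s \<le> r (X i) / real M" and s: "0 < s"
  obtains B where
    "\<And>x. posterior_variance k r M N X x = k x x - (\<Sum>i<N. \<Sum>j<N. B i j * k (X i) x * k (X j) x)"
    "\<And>f l. \<lbrakk>0 \<le> l; \<And>y. l * (\<Sum>i<N. f i * y i)\<^sup>2 \<le> (\<Sum>i<N. \<Sum>j<N. y i * y j * k (X i) (X j))\<rbrakk>
      \<Longrightarrow> (\<Sum>i<N. \<Sum>j<N. B i j * f i * f j) \<le> (\<Sum>i<N. (f i)\<^sup>2) / (s + l * (\<Sum>i<N. (f i)\<^sup>2))"
proof -
  define A where "A = gram_matrix k N X + (1 / real M) \<cdot>\<^sub>m noise_matrix r N X"
  have carrier_A: "A \<in> carrier_mat N N"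
    unfolding A_def gram_matrix_def noise_matrix_def by simp
  have A_form: "scalar_prod y (A *\<^sub>v y) =
      (\<Sum>i<N. \<Sum>j<N. vec_index y i * vec_index y j * k (X i) (X j)) + (\<Sum>i<N. r (X i) / real M * (vec_index y i)\<^sup>2)"
    if y: "y \<in> carrier_vec N" for y
  proof -
    have "scalar_prod y (A *\<^sub>v y) = (\<Sum>i<N. \<Sum>j<N. vec_index y i * (A $$ (i, j) * vec_index y j))"
      using y carrier_A
      by (auto simp: scalar_prod_def mult_mat_vec_def row_def atLeast0LessThan sum_distrib_left
               intro!: sum.cong)
    also have "\<dots> = (\<Sum>i<N. \<Sum>j<N. vec_index y i * vec_index y j * k (X i) (X j)
                       + (if i = j then r (X i) / real M * (vec_index y i)\<^sup>2 else 0))"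
      by (intro sum.cong refl)
         (auto simp: A_def gram_matrix_def noise_matrix_def algebra_simps power2_eq_square)
    finally show ?thesis by (simp add: sum.distrib)
  qed
  have noise_form: "s * (\<Sum>i<N. (z i)\<^sup>2) \<le> (\<Sum>i<N. r (X i) / real M * (z i)\<^sup>2)" for z
    unfolding sum_distrib_left using noise by (intro sum_mono mult_right_mono) auto
  have "det A \<noteq> 0"
  proof
    assume "det A = 0"
    then obtain y where y: "y \<in> carrier_vec N" "y \<noteq> 0\<^sub>v N" "A *\<^sub>v y = 0\<^sub>v N"
      using det_0_iff_vec_prod_zero_field[OF carrier_A] by auto
    have "s * (\<Sum>i<N. (vec_index y i)\<^sup>2) \<le> scalar_prod y (A *\<^sub>v y)"
      using A_form[OF y(1)] psd[of "\<lambda>i. vec_index y i"] noise_form[of "\<lambda>i. vec_index y i"] by linarith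
    also have "\<dots> = 0" using y by simp
    finally have "(\<Sum>i<N. (vec_index y i)\<^sup>2) \<le> 0" using s by (simp add: mult_le_0_iff)
    then have "(\<Sum>i<N. (vec_index y i)\<^sup>2) = 0" by (intro antisym sum_nonneg) auto
    then have "\<forall>i<N. vec_index y i = 0" by (subst (asm) sum_nonneg_eq_0_iff) auto
    then show False using y by (auto intro!: eq_vecI)
  qed
  then obtain Q where Q: "mat_inverse A = Some Q"
    using mat_inverse(1)[OF carrier_A] det_non_zero_imp_unit[OF carrier_A] by fastforce
  then have AQ: "A * Q = 1\<^sub>m N" and carrier_Q: "Q \<in> carrier_mat N N"
    using mat_inverse(2)[OF carrier_A] by auto
  define B where "B = (\<lambda>i j. Q $$ (i, j))"
  have Q_form: "scalar_prod (Matrix.vec N f) (Q *\<^sub>v Matrix.vec N f) = (\<Sum>i<N. \<Sum>j<N. B i j * f i * f j)" for f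
    using carrier_Q
    by (auto simp: scalar_prod_def mult_mat_vec_def row_def atLeast0LessThan sum_distrib_left B_def
             intro!: sum.cong)
  show thesis
  proof
    show "posterior_variance k r M N X x = k x x - (\<Sum>i<N. \<Sum>j<N. B i j * k (X i) x * k (X j) x)" for x
      unfolding posterior_variance_def A_def[symmetric] Q option.sel kernel_vector_def Q_form ..
  next
    fix f l
    assume l: "0 \<le> l"
      and dom: "\<And>y. l * (\<Sum>i<N. f i * y i)\<^sup>2 \<le> (\<Sum>i<N. \<Sum>j<N. y i * y j * k (X i) (X j))"
    define y where "y = Q *\<^sub>v Matrix.vec N f"
    have y: "y \<in> carrier_vec N" unfolding y_def using carrier_Q by auto
    have Ay: "A *\<^sub>v y = Matrix.vec N f"
      unfolding y_def using carrier_A carrier_Q AQ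
      by (metis assoc_mult_mat_vec one_mult_mat_vec vec_carrier)
    have fy: "(\<Sum>i<N. \<Sum>j<N. B i j * f i * f j) = (\<Sum>i<N. f i * vec_index y i)"
      unfolding Q_form[symmetric] y_def[symmetric]
      using y by (auto simp: scalar_prod_def atLeast0LessThan intro!: sum.cong)
    also have "\<dots> = scalar_prod y (A *\<^sub>v y)"
      unfolding Ay using y by (auto simp: scalar_prod_def atLeast0LessThan intro!: sum.cong)
    finally have "s * (\<Sum>i<N. (vec_index y i)\<^sup>2) + l * (\<Sum>i<N. f i * vec_index y i)\<^sup>2 \<le> (\<Sum>i<N. f i * vec_index y i)"
      using A_form[OF y] dom[of "\<lambda>i. vec_index y i"] noise_form[of "\<lambda>i. vec_index y i"] fy by linarith
    then show "(\<Sum>i<N. \<Sum>j<N. B i j * f i * f j) \<le> (\<Sum>i<N. (f i)\<^sup>2) / (s + l * (\<Sum>i<N. (f i)\<^sup>2))"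
      unfolding fy by (intro sum_product_le_of_quadratic_bound s l)
  qed
qed

section \<open>A lower bound for all observation points\<close>

lemma has_sum_finite_sum:
  fixes f :: "'i \<Rightarrow> 'a \<Rightarrow> 'b::topological_comm_monoid_add"
  assumes "finite J" "\<And>i. i \<in> J \<Longrightarrow> (f i has_sum a i) A"
  shows "((\<lambda>x. \<Sum>i\<in>J. f i x) has_sum (\<Sum>i\<in>J. a i)) A"
  using assms by (induction J rule: finite_induct) (auto intro: has_sum_add)

text \<open>
  The Mercer expansion holds at every pair of points of the space, not only almost everywhere.
  A kernel on a subset is brought into this form by extending it and its
  eigenfunctions by zero.
\<close>

locale bounded_mercer_kernel = prob_space \<nu> for \<nu> :: "'a measure" +
  fixes k :: "'a \<Rightarrow> 'a \<Rightarrow> real" and I :: "nat set" and lam :: "nat \<Rightarrow> real"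
    and \<phi> :: "nat \<Rightarrow> 'a \<Rightarrow> real" and b :: real
  assumes lam_pos: "i \<in> I \<Longrightarrow> 0 < lam i"
    and phi_measurable [measurable]: "i \<in> I \<Longrightarrow> \<phi> i \<in> borel_measurable \<nu>"
    and phi_square_integrable: "i \<in> I \<Longrightarrow> integrable \<nu> (\<lambda>x. (\<phi> i x)\<^sup>2)"
    and phi_orthonormal:
      "\<lbrakk>i \<in> I; j \<in> I\<rbrakk> \<Longrightarrow> (\<integral>x. \<phi> i x * \<phi> j x \<partial>\<nu>) = (if i = j then 1 else 0)"
    and mercer: "((\<lambda>i. lam i * \<phi> i x * \<phi> i y) has_sum k x y) I"
    and diag_le: "k x x \<le> b"
begin

definition truncated :: "nat \<Rightarrow> 'a \<Rightarrow> 'a \<Rightarrow> real" where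
  "truncated n x y = (\<Sum>p\<in>I \<inter> {..<n}. lam p * \<phi> p x * \<phi> p y)"

lemma truncated_tendsto: "(\<lambda>n. truncated n x y) \<longlonglongrightarrow> k x y"
proof -
  have "((\<lambda>p. if p \<in> I then lam p * \<phi> p x * \<phi> p y else 0) has_sum k x y) UNIV"
    using mercer[of x y] by (subst has_sum_cong_neutral[where T = I]) auto
  then have "(\<lambda>n. \<Sum>p<n. if p \<in> I then lam p * \<phi> p x * \<phi> p y else 0) \<longlonglongrightarrow> k x y"
    using has_sum_imp_sums unfolding sums_def by blast
  then show ?thesis
    unfolding truncated_def by (simp add: sum.inter_restrict[symmetric] Int_commute)
qed

lemma finite_sum_diag_le:
  assumes "finite J" "J \<subseteq> I"
  shows "(\<Sum>p\<in>J. lam p * (\<phi> p x)\<^sup>2) \<le> b"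
proof -
  have "(\<Sum>p\<in>J. lam p * \<phi> p x * \<phi> p x) \<le> k x x"
    using assms lam_pos
    by (intro finite_sum_le_has_sum[OF mercer]) (auto simp: mult.assoc less_imp_le)
  then show ?thesis using diag_le[of x] by (simp add: power2_eq_square mult.assoc)
qed

lemma bound_nonneg: "0 \<le> b"
  using finite_sum_diag_le[of "{}"] by simp

text \<open>
  This domination, uniform in \<open>n\<close>, is what makes it possible to integrate products of Mercer
  expansions term by term; it comes from the arithmetic-geometric mean inequality and the bound
  on the diagonal.
\<close>

lemma abs_truncated_le: "\<bar>truncated n x y\<bar> \<le> b"
proof -
  have "\<bar>truncated n x y\<bar> \<le> (\<Sum>p\<in>I \<inter> {..<n}. lam p * (\<phi> p x)\<^sup>2 / 2 + lam p * (\<phi> p y)\<^sup>2 / 2)"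
    unfolding truncated_def
  proof (rule order_trans[OF sum_abs sum_mono])
    fix p assume "p \<in> I \<inter> {..<n}"
    then have l: "0 < lam p" using lam_pos by auto
    have "\<bar>\<phi> p x * \<phi> p y\<bar> \<le> (\<phi> p x)\<^sup>2 / 2 + (\<phi> p y)\<^sup>2 / 2"
      using sum_squares_bound[of "\<bar>\<phi> p x\<bar>" "\<bar>\<phi> p y\<bar>"] by (simp add: abs_mult)
    then show "\<bar>lam p * \<phi> p x * \<phi> p y\<bar> \<le> lam p * (\<phi> p x)\<^sup>2 / 2 + lam p * (\<phi> p y)\<^sup>2 / 2"
      using mult_left_mono[OF _ less_imp_le[OF l]] l
      by (fastforce simp: abs_mult mult.assoc distrib_left)
  qed
  also have "\<dots> \<le> b / 2 + b / 2"
    unfolding sum.distrib sum_divide_distrib[symmetric]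
    by (intro add_mono divide_right_mono finite_sum_diag_le) auto
  finally show ?thesis by simp
qed

lemma product_integrable:
  assumes "i \<in> I" "j \<in> I"
  shows "integrable \<nu> (\<lambda>x. \<phi> i x * \<phi> j x)"
proof (rule Bochner_Integration.integrable_bound)
  show "integrable \<nu> (\<lambda>x. (\<phi> i x)\<^sup>2 + (\<phi> j x)\<^sup>2)"
    using assms phi_square_integrable by simp
  show "(\<lambda>x. \<phi> i x * \<phi> j x) \<in> borel_measurable \<nu>" using assms by measurable
  have "\<bar>\<phi> i x * \<phi> j x\<bar> \<le> (\<phi> i x)\<^sup>2 + (\<phi> j x)\<^sup>2" for x
  proof -
    have "2 * (\<bar>\<phi> i x\<bar> * \<bar>\<phi> j x\<bar>) \<le> (\<phi> i x)\<^sup>2 + (\<phi> j x)\<^sup>2"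
      using sum_squares_bound[of "\<bar>\<phi> i x\<bar>" "\<bar>\<phi> j x\<bar>"] by simp
    moreover have "0 \<le> \<bar>\<phi> i x\<bar> * \<bar>\<phi> j x\<bar>" by simp
    ultimately show ?thesis unfolding abs_mult by linarith
  qed
  then show "AE x in \<nu>. norm (\<phi> i x * \<phi> j x) \<le> norm ((\<phi> i x)\<^sup>2 + (\<phi> j x)\<^sup>2)"
    by auto
qed

lemma truncated_measurable:
  "(\<lambda>x. truncated n y x) \<in> borel_measurable \<nu>" "(\<lambda>x. truncated n x x) \<in> borel_measurable \<nu>"
  unfolding truncated_def by (auto intro!: borel_measurable_sum)

lemma integral_truncated_diag:
  "integrable \<nu> (\<lambda>x. truncated n x x)"
  "(\<integral>x. truncated n x x \<partial>\<nu>) = (\<Sum>p\<in>I \<inter> {..<n}. lam p)"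
proof -
  have int: "integrable \<nu> (\<lambda>x. lam p * (\<phi> p x * \<phi> p x))" if "p \<in> I" for p
    using product_integrable[OF that that] by simp
  then show "integrable \<nu> (\<lambda>x. truncated n x x)"
    unfolding truncated_def by (auto simp: mult.assoc)
  show "(\<integral>x. truncated n x x \<partial>\<nu>) = (\<Sum>p\<in>I \<inter> {..<n}. lam p)"
    unfolding truncated_def mult.assoc using int phi_orthonormal
    by (subst Bochner_Integration.integral_sum) auto
qed

lemma integral_truncated_product:
  "integrable \<nu> (\<lambda>x. truncated n y x * truncated n z x)"
  "(\<integral>x. truncated n y x * truncated n z x \<partial>\<nu>) = (\<Sum>p\<in>I \<inter> {..<n}. (lam p)\<^sup>2 * \<phi> p y * \<phi> p z)"
proof -
  have eq: "truncated n y x * truncated n z x = (\<Sum>p\<in>I \<inter> {..<n}. \<Sum>q\<in>I \<inter> {..<n}.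
      (lam p * \<phi> p y * lam q * \<phi> q z) * (\<phi> p x * \<phi> q x))" for x
    unfolding truncated_def sum_product by (intro sum.cong) auto
  have int: "integrable \<nu> (\<lambda>x. (lam p * \<phi> p y * lam q * \<phi> q z) * (\<phi> p x * \<phi> q x))"
    if "p \<in> I" "q \<in> I" for p q
    using product_integrable[OF that] by simp
  then show "integrable \<nu> (\<lambda>x. truncated n y x * truncated n z x)"
    unfolding eq by (intro Bochner_Integration.integrable_sum) auto
  have "(\<integral>x. truncated n y x * truncated n z x \<partial>\<nu>)
      = (\<Sum>p\<in>I \<inter> {..<n}. \<Sum>q\<in>I \<inter> {..<n}. (lam p * \<phi> p y * lam q * \<phi> q z) * (if p = q then 1 else 0))"
  proof -
    have "(\<integral>x. truncated n y x * truncated n z x \<partial>\<nu>) = (\<Sum>p\<in>I \<inter> {..<n}.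
        \<integral>x. (\<Sum>q\<in>I \<inter> {..<n}. (lam p * \<phi> p y * lam q * \<phi> q z) * (\<phi> p x * \<phi> q x)) \<partial>\<nu>)"
      unfolding eq by (intro Bochner_Integration.integral_sum Bochner_Integration.integrable_sum int) auto
    also have "\<dots> = (\<Sum>p\<in>I \<inter> {..<n}. \<Sum>q\<in>I \<inter> {..<n}.
        \<integral>x. (lam p * \<phi> p y * lam q * \<phi> q z) * (\<phi> p x * \<phi> q x) \<partial>\<nu>)"
      by (intro sum.cong refl Bochner_Integration.integral_sum int) auto
    also have "\<dots> = (\<Sum>p\<in>I \<inter> {..<n}. \<Sum>q\<in>I \<inter> {..<n}.
        (lam p * \<phi> p y * lam q * \<phi> q z) * (if p = q then 1 else 0))"
      by (intro sum.cong refl) (simp add: phi_orthonormal)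
    finally show ?thesis .
  qed
  also have "\<dots> = (\<Sum>p\<in>I \<inter> {..<n}. (lam p)\<^sup>2 * \<phi> p y * \<phi> p z)"
    by (intro sum.cong refl) (auto simp: power2_eq_square if_distrib sum.delta cong: if_cong)
  finally show "(\<integral>x. truncated n y x * truncated n z x \<partial>\<nu>) = (\<Sum>p\<in>I \<inter> {..<n}. (lam p)\<^sup>2 * \<phi> p y * \<phi> p z)" .
qed

lemma gram_form_has_sum:
  fixes N :: nat
  shows "((\<lambda>p. lam p * (\<Sum>i<N. \<phi> p (X i) * y i)\<^sup>2) has_sum (\<Sum>i<N. \<Sum>j<N. y i * y j * k (X i) (X j))) I"
proof -
  have "((\<lambda>p. \<Sum>i<N. \<Sum>j<N. y i * y j * (lam p * \<phi> p (X i) * \<phi> p (X j)))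
      has_sum (\<Sum>i<N. \<Sum>j<N. y i * y j * k (X i) (X j))) I"
    by (intro has_sum_finite_sum has_sum_cmult_right mercer) auto
  moreover have "(\<Sum>i<N. \<Sum>j<N. y i * y j * (lam p * \<phi> p (X i) * \<phi> p (X j)))
      = lam p * (\<Sum>i<N. \<phi> p (X i) * y i)\<^sup>2" for p
    by (simp only: power2_eq_square sum_product) (simp add: sum_distrib_left ac_simps)
  ultimately show ?thesis by simp
qed

lemma gram_form_nonneg:
  fixes N :: nat
  shows "0 \<le> (\<Sum>i<N. \<Sum>j<N. y i * y j * k (X i) (X j))"
  using finite_sum_le_has_sum[OF gram_form_has_sum, of "{}"] lam_pos by (auto simp: less_imp_le)

text \<open>
  The lower bound holds for every choice of the observation points. Term by term integration of
  \<open>k(y,y) - k\<^sub>y\<^sup>T B k\<^sub>y\<close>, where \<open>k\<^sub>y\<close> is the vector of the \<open>k(X i, y)\<close>, gives the sum over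
  all \<open>p\<close> of \<open>lam p - (lam p)\<^sup>2 f\<^sub>p\<^sup>T B f\<^sub>p\<close>, where \<open>f\<^sub>p\<close> is the vector of the values
  \<open>\<phi> p (X i)\<close>. As the Gram matrix dominates
  \<open>lam p f\<^sub>p f\<^sub>p\<^sup>T\<close>, each summand is at least its value for the one-dimensional kernel
  \<open>lam p \<phi>\<^sub>p \<phi>\<^sub>p\<close>. All summands are nonnegative, so any finite set \<open>J\<close> of
  modes may be kept.
\<close>

lemma integral_posterior_variance_ge:
  assumes noise: "\<And>i. i < N \<Longrightarrow> s \<le> r (X i) / real M" and s: "0 < s"
    and J: "finite J" "J \<subseteq> I"
  shows "(\<Sum>p\<in>J. s * lam p / (s + lam p * (\<Sum>i<N. (\<phi> p (X i))\<^sup>2)))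
           \<le> (\<integral>x. posterior_variance k r M N X x \<partial>\<nu>)"
proof -
  have gram_ge: "lam p * (\<Sum>i<N. \<phi> p (X i) * y i)\<^sup>2 \<le> (\<Sum>i<N. \<Sum>j<N. y i * y j * k (X i) (X j))"
    if "p \<in> I" for p y
    using finite_sum_le_has_sum[OF gram_form_has_sum, of "{p}"] that lam_pos
    by (auto simp: less_imp_le)
  obtain B where pv: "\<And>x. posterior_variance k r M N X x
        = k x x - (\<Sum>i<N. \<Sum>j<N. B i j * k (X i) x * k (X j) x)"
    and B_le: "\<And>f l. \<lbrakk>0 \<le> l; \<And>y. l * (\<Sum>i<N. f i * y i)\<^sup>2 \<le> (\<Sum>i<N. \<Sum>j<N. y i * y j * k (X i) (X j))\<rbrakk>
      \<Longrightarrow> (\<Sum>i<N. \<Sum>j<N. B i j * f i * f j) \<le> (\<Sum>i<N. (f i)\<^sup>2) / (s + l * (\<Sum>i<N. (f i)\<^sup>2))"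
    using posterior_variance_quadratic_form[where N = N and k = k and X = X and s = s and r = r and M = M]
      gram_form_nonneg noise s by blast
  define g where "g n x = truncated n x x
      - (\<Sum>i<N. \<Sum>j<N. B i j * (truncated n (X i) x * truncated n (X j) x))" for n x
  define t where "t p = s * lam p / (s + lam p * (\<Sum>i<N. (\<phi> p (X i))\<^sup>2))" for p
  have t_nonneg: "0 \<le> t p" if "p \<in> I" for p
    unfolding t_def using s lam_pos[OF that]
    by (intro divide_nonneg_nonneg mult_nonneg_nonneg add_nonneg_nonneg sum_nonneg) auto
  have t_le: "t p \<le> lam p - (lam p)\<^sup>2 * (\<Sum>i<N. \<Sum>j<N. B i j * \<phi> p (X i) * \<phi> p (X j))"
    if p: "p \<in> I" for p
  proof -
    define S where "S = (\<Sum>i<N. (\<phi> p (X i))\<^sup>2)"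
    have "0 \<le> S" unfolding S_def by (intro sum_nonneg) auto
    then have pos: "0 < s + lam p * S" using s lam_pos[OF p] by (intro add_pos_nonneg) auto
    have "(lam p)\<^sup>2 * (\<Sum>i<N. \<Sum>j<N. B i j * \<phi> p (X i) * \<phi> p (X j)) \<le> (lam p)\<^sup>2 * (S / (s + lam p * S))"
      unfolding S_def using lam_pos[OF p] gram_ge[OF p]
      by (intro mult_left_mono B_le) (auto simp: less_imp_le)
    moreover have "t p = lam p - (lam p)\<^sup>2 * (S / (s + lam p * S))"
      using pos unfolding t_def S_def[symmetric] by (simp add: field_simps power2_eq_square)
    ultimately show ?thesis by simp
  qed
  have "(\<lambda>n. \<integral>x. g n x \<partial>\<nu>) \<longlonglongrightarrow> (\<integral>x. posterior_variance k r M N X x \<partial>\<nu>)"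
  proof (rule integral_dominated_convergence[where w = "\<lambda>_. b + (\<Sum>i<N. \<Sum>j<N. \<bar>B i j\<bar> * (b * b))"])
    have lim: "(\<lambda>n. g n x) \<longlonglongrightarrow> posterior_variance k r M N X x" for x
      unfolding g_def pv mult.assoc by (intro tendsto_intros truncated_tendsto)
    show meas: "g n \<in> borel_measurable \<nu>" for n
      unfolding g_def using truncated_measurable by measurable
    show "posterior_variance k r M N X \<in> borel_measurable \<nu>"
      by (rule borel_measurable_LIMSEQ_real[OF lim meas])
    show "AE x in \<nu>. (\<lambda>n. g n x) \<longlonglongrightarrow> posterior_variance k r M N X x" using lim by simp
    have "\<bar>g n x\<bar> \<le> b + (\<Sum>i<N. \<Sum>j<N. \<bar>B i j\<bar> * (b * b))" for n x
    proof -
      have "\<bar>\<Sum>i<N. \<Sum>j<N. B i j * (truncated n (X i) x * truncated n (X j) x)\<bar>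
          \<le> (\<Sum>i<N. \<Sum>j<N. \<bar>B i j\<bar> * (b * b))"
        by (intro order_trans[OF sum_abs] sum_mono)
           (auto simp: abs_mult intro!: mult_left_mono mult_mono abs_truncated_le bound_nonneg)
      then show ?thesis
        unfolding g_def using abs_truncated_le[of n x x] by linarith
    qed
    then show "AE x in \<nu>. norm (g n x) \<le> b + (\<Sum>i<N. \<Sum>j<N. \<bar>B i j\<bar> * (b * b))" for n
      by simp
  qed simp
  moreover have "(\<Sum>p\<in>J. t p) \<le> (\<integral>x. g n x \<partial>\<nu>)" if n: "J \<subseteq> {..<n}" for n
  proof -
    have "(\<Sum>p\<in>J. t p) \<le> (\<Sum>p\<in>I \<inter> {..<n}. t p)"
      using J n t_nonneg by (intro sum_mono2) auto
    also have "\<dots> \<le> (\<Sum>p\<in>I \<inter> {..<n}. lam p - (lam p)\<^sup>2 * (\<Sum>i<N. \<Sum>j<N. B i j * \<phi> p (X i) * \<phi> p (X j)))"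
      using t_le by (intro sum_mono) auto
    also have "\<dots> = (\<Sum>p\<in>I \<inter> {..<n}. lam p)
        - (\<Sum>p\<in>I \<inter> {..<n}. \<Sum>i<N. \<Sum>j<N. B i j * ((lam p)\<^sup>2 * \<phi> p (X i) * \<phi> p (X j)))"
      by (simp add: sum_subtractf sum_distrib_left mult.assoc mult.left_commute)
    also have "\<dots> = (\<Sum>p\<in>I \<inter> {..<n}. lam p)
        - (\<Sum>i<N. \<Sum>j<N. B i j * (\<Sum>p\<in>I \<inter> {..<n}. (lam p)\<^sup>2 * \<phi> p (X i) * \<phi> p (X j)))"
      by (simp add: sum_distrib_left sum.swap[where A = "I \<inter> {..<n}"])
    also have "\<dots> = (\<integral>x. g n x \<partial>\<nu>)"
      unfolding g_def by (simp add: integral_truncated_diag integral_truncated_product)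
    finally show ?thesis .
  qed
  moreover obtain m where "\<forall>p\<in>J. p < m" using J(1) finite_nat_set_iff_bounded by blast
  ultimately have "(\<Sum>p\<in>J. t p) \<le> (\<integral>x. posterior_variance k r M N X x \<partial>\<nu>)"
    by (intro LIMSEQ_le_const) (auto intro!: exI[of _ m], meson lessThan_iff less_le_trans subsetI)
  then show ?thesis unfolding t_def .
qed

end

section \<open>Effective dimension and frozen weights\<close>

context bounded_mercer_kernel
begin

lemma finite_sum_eigenvalues_le:
  assumes "finite J" "J \<subseteq> I"
  shows "(\<Sum>p\<in>J. lam p) \<le> b"
proof -
  have int: "integrable \<nu> (\<lambda>x. lam p * (\<phi> p x)\<^sup>2)" if "p \<in> J" for p
    using phi_square_integrable that assms(2) by auto
  have "(\<Sum>p\<in>J. lam p) = (\<integral>x. (\<Sum>p\<in>J. lam p * (\<phi> p x)\<^sup>2) \<partial>\<nu>)"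
    using int phi_orthonormal assms(2)
    by (subst Bochner_Integration.integral_sum) (auto simp: power2_eq_square intro!: sum.cong)
  also have "\<dots> \<le> (\<integral>x. b \<partial>\<nu>)"
    using int finite_sum_diag_le[OF assms] by (intro integral_mono) auto
  finally show ?thesis by (simp add: prob_space)
qed

lemma eigenvalues_summable: "lam summable_on I"
  using finite_sum_eigenvalues_le lam_pos
  by (intro nonneg_bdd_above_summable_on bdd_aboveI[of _ b]) (auto simp: less_imp_le)

text \<open>
  The weight of mode \<open>p\<close> is the fraction of its prior variance that is removed by \<open>n\<close> ideal
  observations with noise variance \<open>s\<close>; the sum of the weights over all modes is the effective
  dimension, also called degrees of freedom, of the regression problem.
\<close>

definition mode_weight :: "real \<Rightarrow> nat \<Rightarrow> nat \<Rightarrow> real" where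
  "mode_weight s n p = real n * lam p / (s + real n * lam p)"

definition effective_dimension :: "real \<Rightarrow> nat \<Rightarrow> real" where
  "effective_dimension s n = (\<Sum>\<^sub>\<infinity>p\<in>I. mode_weight s n p)"

context
  fixes s :: real
  assumes s: "0 < s"
begin

lemma mode_weight_bounds:
  assumes "p \<in> I"
  shows "0 \<le> mode_weight s n p" "mode_weight s n p \<le> 1"
    "mode_weight s n p \<le> real n * lam p / s"
  using s lam_pos[OF assms] unfolding mode_weight_def
  by (auto simp: divide_le_eq_1 add_pos_nonneg intro!: divide_left_mono)

lemma mode_weight_pos: "\<lbrakk>p \<in> I; 1 \<le> n\<rbrakk> \<Longrightarrow> 0 < mode_weight s n p"
  using s lam_pos unfolding mode_weight_def by (auto intro!: divide_pos_pos add_pos_pos mult_pos_pos)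

lemma mode_weight_mono:
  assumes "p \<in> I" "m \<le> n"
  shows "mode_weight s m p \<le> mode_weight s n p"
proof -
  have eq: "mode_weight s i p = 1 - s / (s + real i * lam p)" for i
    using s lam_pos[OF assms(1)] add_pos_nonneg[of s "real i * lam p"]
    unfolding mode_weight_def by (simp add: field_simps)
  show ?thesis
    unfolding eq using s lam_pos[OF assms(1)] assms(2)
    by (intro diff_left_mono divide_left_mono add_left_mono mult_right_mono mult_pos_pos add_pos_nonneg) auto
qed

lemma mode_weight_summable: "mode_weight s n summable_on I"
  using mode_weight_bounds
  by (intro summable_on_comparison_test[OF summable_on_cmult_right[OF eigenvalues_summable, of "real n / s"]])
     auto

lemma effective_dimension_mono: "m \<le> n \<Longrightarrow> effective_dimension s m \<le> effective_dimension s n"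
  unfolding effective_dimension_def by (intro infsum_mono mode_weight_summable mode_weight_mono)

lemma effective_dimension_pos:
  assumes "I \<noteq> {}" "1 \<le> n"
  shows "0 < effective_dimension s n"
proof -
  obtain p where p: "p \<in> I" using assms by auto
  have "0 < (\<Sum>q\<in>{p}. mode_weight s n q)" using mode_weight_pos[OF p assms(2)] by simp
  also have "\<dots> \<le> effective_dimension s n"
    unfolding effective_dimension_def using p mode_weight_bounds
    by (intro finite_sum_le_infsum mode_weight_summable) auto
  finally show ?thesis .
qed

lemma effective_dimension_finite_approx:
  assumes "C < effective_dimension s n"
  obtains J where "finite J" "J \<subseteq> I" "C < (\<Sum>p\<in>J. mode_weight s n p)"
proof -
  have "(sum (mode_weight s n) \<longlongrightarrow> effective_dimension s n) (finite_subsets_at_top I)"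
    using has_sum_infsum[OF mode_weight_summable, of n]
    unfolding effective_dimension_def has_sum_def .
  then have "\<forall>\<^sub>F J in finite_subsets_at_top I. C < (\<Sum>p\<in>J. mode_weight s n p)"
    using assms by (rule order_tendstoD(1))
  then obtain J where "finite J" "J \<subseteq> I" "C < (\<Sum>p\<in>J. mode_weight s n p)"
    unfolding eventually_finite_subsets_at_top by blast
  then show thesis by (rule that)
qed

text \<open>
  Squared weights appear because the lower bound is linearised at the weights: these are the
  coefficients of the empirical means of \<open>(\<phi> p)\<^sup>2\<close> in the first-order term.
\<close>

definition mode_energy :: "nat set \<Rightarrow> nat \<Rightarrow> 'a \<Rightarrow> real" where
  "mode_energy J n y = (\<Sum>p\<in>J. (mode_weight s n p)\<^sup>2 * (\<phi> p y)\<^sup>2)"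

text \<open>
  A weight lies between 0 and 1 and is at most \<open>n * lam p / s\<close>, so the energy is controlled by the
  diagonal of the kernel even though the eigenfunctions themselves may be unbounded.
\<close>

lemma mode_energy_bounds:
  assumes "finite J" "J \<subseteq> I"
  shows "0 \<le> mode_energy J n y" "mode_energy J n y \<le> real n * b / s"
proof -
  show "0 \<le> mode_energy J n y" unfolding mode_energy_def by (intro sum_nonneg) auto
  have "mode_energy J n y \<le> (\<Sum>p\<in>J. real n / s * (lam p * (\<phi> p y)\<^sup>2))"
    unfolding mode_energy_def
  proof (rule sum_mono)
    fix p assume "p \<in> J"
    then have p: "p \<in> I" using assms by auto
    have "(mode_weight s n p)\<^sup>2 \<le> real n * lam p / s"
      using mult_right_mono[OF mode_weight_bounds(2)[OF p, of n] mode_weight_bounds(1)[OF p, of n]] mode_weight_bounds(3)[OF p, of n]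
      by (simp add: power2_eq_square)
    then show "(mode_weight s n p)\<^sup>2 * (\<phi> p y)\<^sup>2 \<le> real n / s * (lam p * (\<phi> p y)\<^sup>2)"
      using mult_right_mono[of _ _ "(\<phi> p y)\<^sup>2"] by fastforce
  qed
  also have "\<dots> \<le> real n / s * b"
    unfolding sum_distrib_left[symmetric] using s
    by (intro mult_left_mono finite_sum_diag_le assms) auto
  finally show "mode_energy J n y \<le> real n * b / s" by simp
qed

lemma mode_energy_measurable:
  assumes "J \<subseteq> I"
  shows "mode_energy J n \<in> borel_measurable \<nu>"
  unfolding mode_energy_def using assms
  by (intro borel_measurable_sum borel_measurable_times borel_measurable_power borel_measurable_const phi_measurable) auto

lemma integral_mode_energy:
  assumes "J \<subseteq> I"
  shows "(\<integral>y. mode_energy J n y \<partial>\<nu>) = (\<Sum>p\<in>J. (mode_weight s n p)\<^sup>2)"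
proof -
  have "(\<integral>y. mode_energy J n y \<partial>\<nu>) = (\<Sum>p\<in>J. \<integral>y. (mode_weight s n p)\<^sup>2 * (\<phi> p y)\<^sup>2 \<partial>\<nu>)"
    unfolding mode_energy_def using assms phi_square_integrable
    by (intro Bochner_Integration.integral_sum) auto
  also have "\<dots> = (\<Sum>p\<in>J. (mode_weight s n p)\<^sup>2)"
    using assms phi_orthonormal by (intro sum.cong refl) (auto simp: power2_eq_square)
  finally show ?thesis .
qed

lemma integral_mode_energy_le:
  assumes "J \<subseteq> I"
  shows "(\<integral>y. mode_energy J n y \<partial>\<nu>) \<le> (\<Sum>p\<in>J. mode_weight s n p)"
  unfolding integral_mode_energy[OF assms]
proof (rule sum_mono)
  fix p assume "p \<in> J"
  then have p: "p \<in> I" using assms by auto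
  show "(mode_weight s n p)\<^sup>2 \<le> mode_weight s n p"
    using mult_right_mono[OF mode_weight_bounds(2)[OF p, of n] mode_weight_bounds(1)[OF p, of n]] by (simp add: power2_eq_square)
qed

text \<open>
  The \<open>p\<close>-th summand, multiplied by \<open>N\<close>, is \<open>1 / d'\<close> with \<open>d' = s / (N * lam p) + S p / N\<close>, where
  \<open>S p / N\<close> is the empirical mean of \<open>(\<phi> p)\<^sup>2\<close>. Replacing \<open>N\<close> by \<open>n \<le> N\<close> in the first term of
  \<open>d'\<close> decreases the reciprocal and leaves \<open>1 / d\<close>, and the empirical mean is now the only part
  that depends on \<open>N\<close>. By convexity of the reciprocal,
  \<open>1 / d \<ge> 2 * v - v\<^sup>2 * d\<close> for every \<open>v\<close>. The choice \<open>v = c * w\<close> with a common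
  factor \<open>c\<close> turns the sum of the right-hand sides into an expression in which the sample enters
  only through the mean energy.
\<close>

lemma mode_sum_ge:
  assumes J: "J \<subseteq> I" and n: "1 \<le> n" "n \<le> N" and "0 < \<delta>"
    and energy: "(\<Sum>i<N. mode_energy J n (X i)) \<le> (1 + \<delta>) * real N *
      ((\<integral>y. mode_energy J n y \<partial>\<nu>) + \<delta> * (\<Sum>p\<in>J. mode_weight s n p))"
  shows "(\<Sum>p\<in>J. mode_weight s n p) / (1 + \<delta>)\<^sup>2
           \<le> real N * (\<Sum>p\<in>J. lam p / (s + lam p * (\<Sum>i<N. (\<phi> p (X i))\<^sup>2)))"
proof -
  define w where "w p = mode_weight s n p" for p
  define W where "W = (\<Sum>p\<in>J. w p)"
  define E where "E = (\<Sum>p\<in>J. (w p)\<^sup>2)"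
  define S where "S p = (\<Sum>i<N. (\<phi> p (X i))\<^sup>2)" for p
  define c where "c = 1 / (1 + \<delta>)\<^sup>2"
  have N: "0 < real N" using n by simp
  have S_nonneg: "0 \<le> S p" for p unfolding S_def by (intro sum_nonneg) auto
  have tangent: "2 * c * w p - c\<^sup>2 * ((w p - (w p)\<^sup>2) + (w p)\<^sup>2 * (S p / real N))
      \<le> real N * (lam p / (s + lam p * S p))" if "p \<in> J" for p
  proof -
    have l: "0 < lam p" using lam_pos J that by auto
    define a where "a = s / (real n * lam p)"
    define d where "d = a + S p / real N"
    have a: "0 < a" unfolding a_def using s l n by auto
    have d: "0 < d" unfolding d_def using a S_nonneg[of p] by (intro add_pos_nonneg) auto
    have "w p * (1 + a) = 1"
    proof -
      define z where "z = real n * lam p"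
      have z: "0 < z" unfolding z_def using l n by simp
      have "1 + s / z = (s + z) / z" using z by (simp add: add_divide_distrib)
      then show ?thesis
        unfolding w_def mode_weight_def a_def z_def[symmetric] using z s by simp
    qed
    then have "(w p)\<^sup>2 * (1 + a) = w p" by (simp add: power2_eq_square mult.assoc)
    then have wa: "(w p)\<^sup>2 * a = w p - (w p)\<^sup>2" by (simp add: distrib_left)
    have "(1 - v * d)\<^sup>2 / d = 1 / d - 2 * v + v\<^sup>2 * d" for v
      using d by (simp add: power2_diff power_mult_distrib diff_divide_distrib add_divide_distrib
          power2_eq_square[of d])
    then have "0 \<le> 1 / d - 2 * (c * w p) + (c * w p)\<^sup>2 * d"
      using d by (metis divide_nonneg_pos zero_le_power2)
    then have "2 * c * w p - c\<^sup>2 * ((w p)\<^sup>2 * d) \<le> 1 / d" by (simp add: mult.assoc power_mult_distrib)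
    moreover have "(w p)\<^sup>2 * d = (w p - (w p)\<^sup>2) + (w p)\<^sup>2 * (S p / real N)"
      unfolding d_def distrib_left wa ..
    moreover have "1 / d \<le> real N * (lam p / (s + lam p * S p))"
    proof -
      have "s / (real N * lam p) + S p / real N \<le> d"
        unfolding d_def a_def using s l n
        by (intro add_right_mono divide_left_mono mult_right_mono) auto
      moreover have "0 < s / (real N * lam p) + S p / real N"
        using s l N S_nonneg[of p] by (intro add_pos_nonneg divide_pos_pos mult_pos_pos divide_nonneg_pos) auto
      ultimately have "1 / d \<le> 1 / (s / (real N * lam p) + S p / real N)"
        using d by (intro divide_left_mono mult_pos_pos) auto
      also have "s / (real N * lam p) + S p / real N = (s + lam p * S p) / (real N * lam p)"
        using l N by (simp add: add_divide_distrib)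
      finally show ?thesis by simp
    qed
    ultimately show ?thesis by simp
  qed
  have "(\<Sum>p\<in>J. (w p)\<^sup>2 * (S p / real N)) = (\<Sum>i<N. mode_energy J n (X i)) / real N"
    unfolding mode_energy_def S_def w_def[symmetric] sum_divide_distrib sum_distrib_left
    by (subst sum.swap) simp
  also have "\<dots> \<le> (1 + \<delta>) * (E + \<delta> * W)"
    using energy N unfolding integral_mode_energy[OF J] w_def[symmetric] E_def W_def
    by (simp add: divide_le_eq mult.assoc mult.commute mult.left_commute)
  finally have energy': "(\<Sum>p\<in>J. (w p)\<^sup>2 * (S p / real N)) \<le> (1 + \<delta>) * (E + \<delta> * W)" .
  have "E \<le> W"
    using integral_mode_energy_le[OF J, of n] unfolding integral_mode_energy[OF J] E_def W_def w_def .
  then have "\<delta> * E \<le> \<delta> * W" using \<open>0 < \<delta>\<close> by simp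
  then have "(W - E) + (1 + \<delta>) * (E + \<delta> * W) \<le> (1 + \<delta>)\<^sup>2 * W"
    by (simp add: algebra_simps power2_eq_square)
  then have "c\<^sup>2 * ((W - E) + (\<Sum>p\<in>J. (w p)\<^sup>2 * (S p / real N))) \<le> c\<^sup>2 * ((1 + \<delta>)\<^sup>2 * W)"
    using energy' by (intro mult_left_mono) auto
  also have "\<dots> = c * W" unfolding c_def using \<open>0 < \<delta>\<close> by (simp add: power2_eq_square)
  finally have "c * W \<le> 2 * c * W - c\<^sup>2 * ((W - E) + (\<Sum>p\<in>J. (w p)\<^sup>2 * (S p / real N)))"
    by linarith
  also have "\<dots> = (\<Sum>p\<in>J. 2 * c * w p - c\<^sup>2 * ((w p - (w p)\<^sup>2) + (w p)\<^sup>2 * (S p / real N)))"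
    unfolding W_def E_def by (simp add: sum_subtractf sum.distrib flip: sum_distrib_left)
  also have "\<dots> \<le> (\<Sum>p\<in>J. real N * (lam p / (s + lam p * S p)))"
    by (intro sum_mono tangent)
  finally show ?thesis unfolding c_def W_def w_def S_def sum_distrib_left[symmetric] by simp
qed

end

end

section \<open>Averages of independent nonnegative random variables\<close>

context prob_space
begin

lemma variance_sum_le:
  fixes Y :: "nat \<Rightarrow> 'a \<Rightarrow> real"
  assumes indep: "indep_vars (\<lambda>_. borel) Y UNIV"
    and bounded: "\<And>i \<omega>. \<bar>Y i \<omega>\<bar> \<le> K"
    and var: "\<And>i. variance (Y i) \<le> V"
  shows "variance (\<lambda>\<omega>. \<Sum>i<m. Y i \<omega>) \<le> real m * V"
proof (induction m)
  case 0
  then show ?case by simp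
next
  case (Suc m)
  define S where "S = (\<lambda>\<omega>. \<Sum>i<m. Y i \<omega>)"
  have meas [measurable]: "Y i \<in> borel_measurable M" for i
    using indep unfolding indep_vars_def by simp
  have [measurable]: "S \<in> borel_measurable M" unfolding S_def by measurable
  have S_bounded: "\<bar>S \<omega>\<bar> \<le> real m * K" for \<omega>
    unfolding S_def using sum_bounded_above[of "{..<m}" "\<lambda>i. \<bar>Y i \<omega>\<bar>" K] bounded
    by (intro order_trans[OF sum_abs]) auto
  have intS: "integrable M S"
    using S_bounded by (intro integrable_const_bound[where B = "real m * K"]) auto
  have intY: "integrable M (Y m)"
    using bounded by (intro integrable_const_bound[where B = K]) auto
  have intS2: "integrable M (\<lambda>\<omega>. (S \<omega>)\<^sup>2)"
    using power_mono[OF S_bounded, where n = 2]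
    by (intro integrable_const_bound[where B = "(real m * K)\<^sup>2"]) auto
  have intY2: "integrable M (\<lambda>\<omega>. (Y m \<omega>)\<^sup>2)"
    using power_mono[OF bounded, where n = 2]
    by (intro integrable_const_bound[where B = "K\<^sup>2"]) auto
  have iv: "indep_var borel (Y m) borel S"
    unfolding S_def by (intro indep_vars_sum indep_vars_subset[OF indep]) auto
  have prod: "expectation (\<lambda>\<omega>. Y m \<omega> * S \<omega>) = expectation (Y m) * expectation S"
    and intP: "integrable M (\<lambda>\<omega>. Y m \<omega> * S \<omega>)"
    using indep_var_lebesgue_integral[OF iv intY intS] indep_var_integrable[OF iv intY intS] by auto
  have eq: "(\<Sum>i<Suc m. Y i \<omega>) = S \<omega> + Y m \<omega>" for \<omega> unfolding S_def by simp
  have sq: "(S \<omega> + Y m \<omega>)\<^sup>2 = (S \<omega>)\<^sup>2 + (Y m \<omega>)\<^sup>2 + 2 * (Y m \<omega> * S \<omega>)" for \<omega>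
    by (simp add: power2_sum mult.commute)
  have "variance (\<lambda>\<omega>. S \<omega> + Y m \<omega>)
      = expectation (\<lambda>\<omega>. (S \<omega> + Y m \<omega>)\<^sup>2) - (expectation (\<lambda>\<omega>. S \<omega> + Y m \<omega>))\<^sup>2"
    using intS intY intS2 intY2 intP by (intro variance_eq) (auto simp: sq)
  also have "\<dots> = variance S + variance (Y m)"
    unfolding sq using intS intY intS2 intY2 intP prod
    by (simp add: variance_eq power2_sum mult.commute)
  also have "\<dots> \<le> real m * V + V"
    using Suc.IH var[of m] unfolding S_def by (intro add_mono)
  finally show ?case unfolding eq by (simp add: distrib_right)
qed

lemma prob_average_far_from_mean_le:
  fixes Y :: "nat \<Rightarrow> 'a \<Rightarrow> real"
  assumes indep: "indep_vars (\<lambda>_. borel) Y UNIV"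
    and bounded: "\<And>i \<omega>. \<bar>Y i \<omega>\<bar> \<le> K"
    and var: "\<And>i. variance (Y i) \<le> V" and mean: "\<And>i. expectation (Y i) = \<mu>"
    and "0 < t" "0 < m"
  shows "prob {\<omega>\<in>space M. real m * t \<le> \<bar>(\<Sum>i<m. Y i \<omega>) - real m * \<mu>\<bar>} \<le> V / (real m * t\<^sup>2)"
proof -
  have meas [measurable]: "Y i \<in> borel_measurable M" for i
    using indep unfolding indep_vars_def by simp
  have int: "integrable M (Y i)" for i
    using bounded by (intro integrable_const_bound[where B = K]) auto
  have S_bounded: "\<bar>\<Sum>i<m. Y i \<omega>\<bar> \<le> real m * K" for \<omega>
    using sum_bounded_above[of "{..<m}" "\<lambda>i. \<bar>Y i \<omega>\<bar>" K] bounded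
    by (intro order_trans[OF sum_abs]) auto
  have E: "expectation (\<lambda>\<omega>. \<Sum>i<m. Y i \<omega>) = real m * \<mu>"
    using int mean by simp
  have "prob {\<omega>\<in>space M. real m * t \<le> \<bar>(\<Sum>i<m. Y i \<omega>) - expectation (\<lambda>\<omega>. \<Sum>i<m. Y i \<omega>)\<bar>}
      \<le> variance (\<lambda>\<omega>. \<Sum>i<m. Y i \<omega>) / (real m * t)\<^sup>2"
    using assms(5,6) power_mono[OF S_bounded, where n = 2]
    by (intro Chebyshev_inequality integrable_const_bound[where B = "(real m * K)\<^sup>2"]) auto
  also have "\<dots> \<le> (real m * V) / (real m * t)\<^sup>2"
    by (intro divide_right_mono variance_sum_le[OF indep bounded var]) auto
  also have "\<dots> = V / (real m * t\<^sup>2)"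
    using assms(6) by (simp add: power2_eq_square)
  finally show ?thesis unfolding E .
qed

text \<open>
  Chebyshev's inequality at a single time decays too slowly to be summed over all \<open>N \<ge> m\<close>, but
  it can be summed over the geometric times \<open>m (1 + \<delta>)\<^sup>j\<close>, and the sum is of the order of its
  first term. Between two such times the partial sums are monotone, because \<open>Y\<close> is nonnegative;
  this costs the factor \<open>1 + \<delta>\<close> and is Etemadi's device in the strong law of large numbers. The
  bound on \<open>prob E\<close> is explicit because it is applied to functions that change with \<open>m\<close>.
\<close>

lemma averages_of_nonneg_uniformly_le:
  fixes Y :: "nat \<Rightarrow> 'a \<Rightarrow> real"
  assumes indep: "indep_vars (\<lambda>_. borel) Y UNIV"
    and nonneg: "\<And>i \<omega>. 0 \<le> Y i \<omega>" and bounded: "\<And>i \<omega>. Y i \<omega> \<le> K"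
    and var: "\<And>i. variance (Y i) \<le> V" and mean: "\<And>i. expectation (Y i) = \<mu>"
    and "0 < t" "0 < m" "0 < \<delta>"
  obtains E where "E \<in> events" "prob E \<le> 2 * (1 + \<delta>) / \<delta> * (V / (real m * t\<^sup>2))"
    "\<And>\<omega> N. \<lbrakk>\<omega> \<in> space M - E; m \<le> N\<rbrakk> \<Longrightarrow> (\<Sum>i<N. Y i \<omega>) \<le> (1 + \<delta>) * real N * (\<mu> + t)"
proof -
  have meas [measurable]: "Y i \<in> borel_measurable M" for i
    using indep unfolding indep_vars_def by simp
  have abs_bounded: "\<bar>Y i \<omega>\<bar> \<le> K" for i \<omega> using nonneg bounded by simp
  have mu: "0 \<le> \<mu>" using mean[of 0] nonneg by (metis Bochner_Integration.integral_nonneg)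
  have V: "0 \<le> V" using var[of 0] variance_positive[of "Y 0"] by linarith
  define q where "q = 1 + \<delta>"
  have q: "1 < q" using assms(8) unfolding q_def by simp
  define m' where "m' j = nat \<lfloor>real m * q ^ j\<rfloor>" for j
  define E where "E j = {\<omega>\<in>space M. real (m' j) * t \<le> \<bar>(\<Sum>i<m' j. Y i \<omega>) - real (m' j) * \<mu>\<bar>}" for j
  \<comment> \<open>Rounding down loses at most a factor 2, which is the 2 in the bound on \<open>prob E\<close>.\<close>
  have one_le: "1 \<le> real m * q ^ j" for j
    using assms(7) q mult_mono[of 1 "real m" 1 "q ^ j"] by (simp add: one_le_power)
  have m'_le: "real (m' j) \<le> real m * q ^ j" for j
    using one_le[of j] unfolding m'_def by (simp add: of_nat_floor)
  have m'_ge: "real m * q ^ j / 2 \<le> real (m' j)" for j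
  proof -
    have "1 \<le> \<lfloor>real m * q ^ j\<rfloor>" using one_le[of j] by simp
    then have "1 \<le> real (m' j)" "real (m' j) = of_int \<lfloor>real m * q ^ j\<rfloor>"
      unfolding m'_def by auto
    then show ?thesis using floor_correct[of "real m * q ^ j"] by linarith
  qed
  have m'_pos: "0 < m' j" for j
    using one_le[of j] unfolding m'_def by linarith
  have E_events: "E j \<in> events" for j unfolding E_def by measurable
  have prob_E: "prob (E j) \<le> 2 * (V / (real m * t\<^sup>2)) * (1 / q) ^ j" for j
  proof -
    have "prob (E j) \<le> V / (real (m' j) * t\<^sup>2)"
      unfolding E_def
      by (rule prob_average_far_from_mean_le[OF indep abs_bounded var mean assms(6) m'_pos])
    also have "\<dots> \<le> V / ((real m * q ^ j / 2) * t\<^sup>2)"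
      using V assms(6,7) q m'_ge m'_pos by (intro divide_left_mono mult_right_mono mult_pos_pos) auto
    also have "\<dots> = 2 * (V / (real m * t\<^sup>2)) * (1 / q) ^ j"
      by (simp add: power_divide ac_simps)
    finally show ?thesis .
  qed
  have geometric: "(\<lambda>j. 2 * (V / (real m * t\<^sup>2)) * (1 / q) ^ j) sums
      (2 * (V / (real m * t\<^sup>2)) * (1 / (1 - 1 / q)))"
    using q by (intro sums_mult geometric_sums) auto
  have summable_E: "summable (\<lambda>j. prob (E j))"
    using prob_E by (intro summable_comparison_test'[OF sums_summable[OF geometric], of 0]) auto
  show thesis
  proof
    show "(\<Union>j. E j) \<in> events" using E_events by auto
    have "prob (\<Union>j. E j) \<le> (\<Sum>j. prob (E j))"
      using E_events summable_E by (intro finite_measure_subadditive_countably) auto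
    also have "\<dots> \<le> (\<Sum>j. 2 * (V / (real m * t\<^sup>2)) * (1 / q) ^ j)"
      by (intro suminf_le prob_E summable_E sums_summable[OF geometric])
    also have "\<dots> = 2 * (V / (real m * t\<^sup>2)) * (1 / (1 - 1 / q))"
      using sums_unique[OF geometric] by simp
    also have "1 / (1 - 1 / q) = q / \<delta>" using q unfolding q_def by (simp add: field_simps)
    also have "2 * (V / (real m * t\<^sup>2)) * (q / \<delta>) = 2 * q / \<delta> * (V / (real m * t\<^sup>2))"
      by (simp add: ac_simps)
    finally show "prob (\<Union>j. E j) \<le> 2 * (1 + \<delta>) / \<delta> * (V / (real m * t\<^sup>2))"
      unfolding q_def .
  next
    fix \<omega> N assume \<omega>: "\<omega> \<in> space M - (\<Union>j. E j)" and N: "m \<le> N"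
    obtain j where "real N < q ^ j" using real_arch_pow[OF q] by blast
    also have "q ^ j \<le> real m * q ^ j" using assms(7) q by simp
    finally have ex: "real N < real m * q ^ j" .
    define j1 where "j1 = (LEAST j. real N < real m * q ^ j)"
    have j1: "real N < real m * q ^ j1" unfolding j1_def using ex by (rule LeastI)
    then have "j1 \<noteq> 0" using N by (intro notI) simp
    then obtain j0 where j0: "j1 = Suc j0" by (cases j1) auto
    then have lower: "real m * q ^ j0 \<le> real N"
      using not_less_Least[of j0 "\<lambda>j. real N < real m * q ^ j"] unfolding j1_def[symmetric] by simp
    have "N \<le> m' j1" using j1 unfolding m'_def by linarith
    then have "(\<Sum>i<N. Y i \<omega>) \<le> (\<Sum>i<m' j1. Y i \<omega>)"
      using nonneg by (intro sum_mono2) auto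
    also have "\<dots> \<le> real (m' j1) * (\<mu> + t)"
      using \<omega> unfolding E_def by (auto simp: distrib_left dest!: spec[of _ j1])
    also have "real (m' j1) \<le> q * real N"
    proof -
      have "real (m' j1) \<le> q * (real m * q ^ j0)" using m'_le[of j1] unfolding j0 by (simp add: mult.left_commute)
      also have "\<dots> \<le> q * real N" using lower q by (intro mult_left_mono) auto
      finally show ?thesis .
    qed
    then have "real (m' j1) * (\<mu> + t) \<le> q * real N * (\<mu> + t)"
      using mu assms(6) by (intro mult_right_mono) auto
    finally show "(\<Sum>i<N. Y i \<omega>) \<le> (1 + \<delta>) * real N * (\<mu> + t)" unfolding q_def .
  qed
qed

text \<open>
  A nonnegative function bounded by \<open>K\<close> has variance at most \<open>K\<close> times its mean, so the
  exceptional probabilities of the functions \<open>h j\<close> are summable and the Borel-Cantelli lemma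
  applies.
\<close>

lemma AE_eventually_averages_le:
  fixes h :: "nat \<Rightarrow> 'b \<Rightarrow> real" and x :: "nat \<Rightarrow> 'a \<Rightarrow> 'b" and \<nu> :: "'b measure"
  assumes indep: "indep_vars (\<lambda>_. \<nu>) x UNIV" and distr: "\<And>i. distr M \<nu> (x i) = \<nu>"
    and meas [measurable]: "\<And>j. h j \<in> borel_measurable \<nu>"
    and nonneg: "\<And>j y. 0 \<le> h j y" and bounded: "\<And>j y. h j y \<le> K j"
    and pos: "\<And>j. 0 < t j" "\<And>j. 0 < m j" "0 < \<delta>"
    and summable: "summable (\<lambda>j. K j * (\<integral>y. h j y \<partial>\<nu>) / (real (m j) * (t j)\<^sup>2))"
  shows "AE \<omega> in M. \<forall>\<^sub>F j in sequentially. \<forall>N\<ge>m j.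
           (\<Sum>i<N. h j (x i \<omega>)) \<le> (1 + \<delta>) * real N * ((\<integral>y. h j y \<partial>\<nu>) + t j)"
proof -
  have x [measurable]: "x i \<in> measurable M \<nu>" for i
    using indep unfolding indep_vars_def by simp
  have exp: "expectation (\<lambda>\<omega>. g (x i \<omega>)) = (\<integral>y. g y \<partial>\<nu>)"
    if [measurable]: "g \<in> borel_measurable \<nu>" for g :: "'b \<Rightarrow> real" and i
    using integral_distr[of "x i" M \<nu> g] distr[of i] by simp
  have var: "variance (\<lambda>\<omega>. h j (x i \<omega>)) \<le> K j * (\<integral>y. h j y \<partial>\<nu>)" for i j
  proof -
    have sq_le: "(h j y)\<^sup>2 \<le> K j * h j y" for y
      unfolding power2_eq_square using nonneg bounded by (intro mult_right_mono) auto
    have K: "0 \<le> K j" using nonneg bounded order_trans by blast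
    have int: "integrable M (\<lambda>\<omega>. h j (x i \<omega>))"
      using nonneg bounded by (intro integrable_const_bound[where B = "K j"]) auto
    have int2: "integrable M (\<lambda>\<omega>. (h j (x i \<omega>))\<^sup>2)"
      using power_mono[OF bounded nonneg, where n = 2]
      by (intro integrable_const_bound[where B = "(K j)\<^sup>2"]) auto
    have "variance (\<lambda>\<omega>. h j (x i \<omega>)) \<le> expectation (\<lambda>\<omega>. (h j (x i \<omega>))\<^sup>2)"
      by (subst variance_eq[OF int int2]) simp
    also have "\<dots> \<le> expectation (\<lambda>\<omega>. K j * h j (x i \<omega>))"
      using int int2 sq_le by (intro integral_mono) auto
    also have "\<dots> = K j * (\<integral>y. h j y \<partial>\<nu>)" using exp[OF meas, of j i] by simp
    finally show ?thesis .
  qed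
  have "\<exists>E. E \<in> events \<and>
      prob E \<le> 2 * (1 + \<delta>) / \<delta> * (K j * (\<integral>y. h j y \<partial>\<nu>) / (real (m j) * (t j)\<^sup>2)) \<and>
      (\<forall>\<omega>\<in>space M - E. \<forall>N\<ge>m j.
        (\<Sum>i<N. h j (x i \<omega>)) \<le> (1 + \<delta>) * real N * ((\<integral>y. h j y \<partial>\<nu>) + t j))" for j
  proof -
    have "indep_vars (\<lambda>_. borel) (\<lambda>i \<omega>. h j (x i \<omega>)) UNIV"
      by (intro indep_vars_compose2[OF indep] meas)
    from averages_of_nonneg_uniformly_le[OF this nonneg bounded var exp[OF meas] pos(1,2,3)]
    obtain E where "E \<in> events"
      "prob E \<le> 2 * (1 + \<delta>) / \<delta> * (K j * (\<integral>y. h j y \<partial>\<nu>) / (real (m j) * (t j)\<^sup>2))"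
      "\<And>\<omega> N. \<lbrakk>\<omega> \<in> space M - E; m j \<le> N\<rbrakk> \<Longrightarrow>
          (\<Sum>i<N. h j (x i \<omega>)) \<le> (1 + \<delta>) * real N * ((\<integral>y. h j y \<partial>\<nu>) + t j)"
      by blast
    then show ?thesis by blast
  qed
  then obtain E where E: "\<And>j. E j \<in> events"
    "\<And>j. prob (E j) \<le> 2 * (1 + \<delta>) / \<delta> * (K j * (\<integral>y. h j y \<partial>\<nu>) / (real (m j) * (t j)\<^sup>2))"
    "\<And>j \<omega> N. \<lbrakk>\<omega> \<in> space M - E j; m j \<le> N\<rbrakk> \<Longrightarrow>
        (\<Sum>i<N. h j (x i \<omega>)) \<le> (1 + \<delta>) * real N * ((\<integral>y. h j y \<partial>\<nu>) + t j)"
    by metis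
  have "summable (\<lambda>j. prob (E j))"
    using E(2)
    by (intro summable_comparison_test'[OF summable_mult[OF summable, of "2 * (1 + \<delta>) / \<delta>"], of 0])
       auto
  then have "AE \<omega> in M. \<forall>\<^sub>F j in sequentially. \<omega> \<in> space M - E j"
    using E(1) by (intro borel_cantelli_AE1) (auto simp: emeasure_eq_measure)
  then show ?thesis
    by (rule AE_mp) (auto intro!: AE_I2 elim!: eventually_mono intro: E(3))
qed

end

section \<open>Scales on which the effective dimension is almost constant\<close>

text \<open>
  \<open>F\<close> will be the effective dimension. On the \<open>j\<close>-th stretch of sample sizes, from \<open>m j\<close> on,
  one works with weights frozen at \<open>n j\<close>; this is harmless while \<open>F\<close> has grown by at most a factor
  \<open>1 + \<delta>\<close>. The failure probability of that stretch is of the order of \<open>n j / (m j * F (n j))\<close>.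
  If \<open>F\<close> is unbounded, stretches are separated by the powers of \<open>1 + \<delta>\<close> passed by \<open>F\<close>, which may
  be very far apart, and \<open>1 / F (n j)\<close> decays geometrically. If \<open>F\<close> is bounded, a single \<open>n\<close> with
  \<open>F n\<close> close to the supremum serves for all large \<open>N\<close>, and \<open>m j\<close> is made to grow instead.
\<close>

lemma growth_scales:
  fixes F :: "nat \<Rightarrow> real"
  assumes mono: "\<And>m n. \<lbrakk>1 \<le> m; m \<le> n\<rbrakk> \<Longrightarrow> F m \<le> F n" and pos: "\<And>n. 1 \<le> n \<Longrightarrow> 0 < F n"
    and \<delta>: "0 < \<delta>"
  obtains n m :: "nat \<Rightarrow> nat"
  where "\<And>j. 1 \<le> n j" "\<And>j. n j \<le> m j" "summable (\<lambda>j. real (n j) / (real (m j) * F (n j)))"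
    "\<And>K. \<forall>\<^sub>F N in sequentially. \<exists>j\<ge>K. m j \<le> N \<and> F N \<le> (1 + \<delta>) * F (n j)"
proof (cases "bdd_above (F ` {1..})")
  case True
  define C where "C = Sup (F ` {1..})"
  have F_le: "F N \<le> C" if "1 \<le> N" for N
    unfolding C_def using that True by (intro cSup_upper) auto
  have C: "0 < C" using F_le[of 1] pos[of 1] by simp
  then have "C / (1 + \<delta>) < C" using \<delta> by (simp add: field_simps)
  then obtain n where n: "1 \<le> n" "C / (1 + \<delta>) < F n"
    using less_cSup_iff[of "F ` {1..}" "C / (1 + \<delta>)"] True unfolding C_def by auto
  show thesis
  proof (rule that[of "\<lambda>_. n" "\<lambda>j. n * 2 ^ j"])
    show "1 \<le> n" "n \<le> n * 2 ^ j" for j :: nat using n(1) by auto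
    have "summable (\<lambda>j. (1 / F n) * (1 / 2 :: real) ^ j)"
      by (intro summable_mult summable_geometric) simp
    also have "(\<lambda>j. (1 / F n) * (1 / 2 :: real) ^ j) = (\<lambda>j. real n / (real (n * 2 ^ j) * F n))"
      using n(1) by (auto simp: fun_eq_iff power_divide)
    finally show "summable (\<lambda>j. real n / (real (n * 2 ^ j) * F n))" .
    fix K
    show "\<forall>\<^sub>F N in sequentially. \<exists>j\<ge>K. n * 2 ^ j \<le> N \<and> F N \<le> (1 + \<delta>) * F n"
    proof (rule eventually_sequentiallyI[of "n * 2 ^ K"])
      fix N assume N: "n * 2 ^ K \<le> N"
      moreover have "1 \<le> n * 2 ^ K" using n(1) by simp
      ultimately have "1 \<le> N" by (rule order_trans[rotated])
      then have "F N \<le> C" by (rule F_le)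
      also have "C \<le> (1 + \<delta>) * F n" using n(2) \<delta> by (simp add: field_simps)
      finally show "\<exists>j\<ge>K. n * 2 ^ j \<le> N \<and> F N \<le> (1 + \<delta>) * F n" using N by auto
    qed
  qed
next
  case False
  have ex: "\<exists>N. 1 \<le> N \<and> y \<le> F N" for y
  proof (rule ccontr)
    assume "\<nexists>N. 1 \<le> N \<and> y \<le> F N"
    then have "F N \<le> y" if "1 \<le> N" for N using that by (meson linear)
    then show False using False by (auto intro: bdd_aboveI[of _ y])
  qed
  define q where "q = 1 + \<delta>"
  have q: "1 < q" using \<delta> unfolding q_def by simp
  define n where "n j = (LEAST N. 1 \<le> N \<and> q ^ j \<le> F N)" for j
  have n: "1 \<le> n j" "q ^ j \<le> F (n j)" for j
    using LeastI_ex[OF ex[of "q ^ j"]] unfolding n_def by auto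
  show thesis
  proof (rule that[of n n])
    show "1 \<le> n j" for j by (rule n(1))
    have "real (n j) / (real (n j) * F (n j)) \<le> (1 / q) ^ j" for j
    proof -
      have "real (n j) / (real (n j) * F (n j)) = 1 / F (n j)" using n(1)[of j] by simp
      also have "\<dots> \<le> 1 / q ^ j" using n(2)[of j] q by (intro divide_left_mono) (auto intro!: mult_pos_pos pos n(1))
      finally show ?thesis by (simp add: power_divide)
    qed
    moreover have "summable (\<lambda>j. (1 / q) ^ j)" using q by (intro summable_geometric) auto
    moreover have "0 \<le> real (n j) / (real (n j) * F (n j))" for j
      using pos[OF n(1), of j] by simp
    ultimately show "summable (\<lambda>j. real (n j) / (real (n j) * F (n j)))"
      by (auto intro: summable_comparison_test'[of "\<lambda>j. (1 / q) ^ j" 0] simp del: times_divide_eq_left)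
    fix K
    show "\<forall>\<^sub>F N in sequentially. \<exists>j\<ge>K. n j \<le> N \<and> F N \<le> (1 + \<delta>) * F (n j)"
    proof (rule eventually_sequentiallyI[of "n K"])
      fix N assume N: "n K \<le> N"
      have N1: "1 \<le> N" using N n(1)[of K] by simp
      define i where "i = (LEAST i. F N < q ^ i)"
      have i: "F N < q ^ i" unfolding i_def using real_arch_pow[OF q] by (rule LeastI_ex)
      have "q ^ K \<le> F N" using n(2)[of K] mono[OF n(1) N] by simp
      then have "q ^ K < q ^ i" using i by simp
      then have "K < i" using q by (simp add: power_strict_increasing_iff)
      then obtain j where j: "i = Suc j" "K \<le> j" by (cases i) auto
      then have "q ^ j \<le> F N"
        using not_less_Least[of j "\<lambda>i. F N < q ^ i"] unfolding i_def[symmetric] by simp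
      then have "n j \<le> N" unfolding n_def using N1 by (intro Least_le) auto
      moreover have "F N \<le> (1 + \<delta>) * F (n j)"
      proof -
        have "F N \<le> q * q ^ j" using i unfolding j by simp
        also have "\<dots> \<le> q * F (n j)" using n(2)[of j] q by (intro mult_left_mono) auto
        finally show ?thesis unfolding q_def .
      qed
      ultimately show "\<exists>j\<ge>K. n j \<le> N \<and> F N \<le> (1 + \<delta>) * F (n j)" using j(2) by auto
    qed
  qed simp
qed

section \<open>The almost sure lower bound\<close>

context bounded_mercer_kernel
begin

text \<open>
  Four factors \<open>1 + \<delta>\<close> are lost: one for passing from \<open>N\<close> to the scale \<open>n j\<close>, one for replacing
  the effective dimension by a finite sum over modes, and two in \<open>mode_sum_ge\<close>. The noise level
  \<open>s\<close> is that of the averaged observations.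
\<close>

lemma AE_eventually_integral_posterior_variance_gt:
  fixes P :: "'w measure" and x :: "nat \<Rightarrow> 'w \<Rightarrow> 'a" and r :: "'a \<Rightarrow> real"
  assumes P: "prob_space P" and indep: "prob_space.indep_vars P (\<lambda>_. \<nu>) x UNIV"
    and distr: "\<And>i. distr P \<nu> (x i) = \<nu>"
    and noise: "AE \<omega> in P. \<forall>i. s \<le> r (x i \<omega>) / real M" and s: "0 < s"
    and I: "I \<noteq> {}" and \<epsilon>: "0 < \<epsilon>"
  shows "AE \<omega> in P. \<forall>\<^sub>F N in sequentially.
           (1 - \<epsilon>) * (s * (\<Sum>\<^sub>\<infinity>p\<in>I. lam p / (s + real N * lam p)))
             < (\<integral>y. posterior_variance k r M N (\<lambda>i. x i \<omega>) y \<partial>\<nu>)"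
proof -
  interpret P: prob_space P by (rule P)
  define \<delta> where "\<delta> = min \<epsilon> 1 / 4"
  have \<delta>: "0 < \<delta>" "\<delta> \<le> 1 / 4" "4 * \<delta> \<le> \<epsilon>" using \<epsilon> unfolding \<delta>_def by auto
  have loss: "1 - \<epsilon> < 1 / (1 + \<delta>) ^ 4"
  proof -
    have "(1 - \<delta>\<^sup>2) ^ 4 < 1" using \<delta> by (intro power_less_one_iff[THEN iffD2]) (auto simp: power_le_one)
    then have "(1 - \<delta>) ^ 4 * (1 + \<delta>) ^ 4 < 1"
      by (simp add: power_mult_distrib[symmetric] power2_eq_square algebra_simps)
    moreover have "1 - \<epsilon> \<le> (1 - \<delta>) ^ 4"
      using Bernoulli_inequality[of "- \<delta>" 4] \<delta> by simp
    ultimately have "(1 - \<epsilon>) * (1 + \<delta>) ^ 4 < 1"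
      using \<delta> by (meson le_less_trans mult_right_mono zero_le_power add_nonneg_nonneg less_imp_le zero_le_one)
    then show ?thesis using \<delta> by (simp add: pos_less_divide_eq)
  qed
  define d where "d = effective_dimension s"
  have d_pos: "0 < d n" if "1 \<le> n" for n
    unfolding d_def using s I that by (rule effective_dimension_pos)
  have d_mono: "d i \<le> d j" if "i \<le> j" for i j
    unfolding d_def by (rule effective_dimension_mono[OF s that])
  obtain n m where n: "\<And>j. 1 \<le> n j" and nm: "\<And>j. n j \<le> m j"
    and summable_nm: "summable (\<lambda>j. real (n j) / (real (m j) * d (n j)))"
    and cover: "\<And>K. \<forall>\<^sub>F N in sequentially. \<exists>j\<ge>K. m j \<le> N \<and> d N \<le> (1 + \<delta>) * d (n j)"
  proof (rule growth_scales[of d \<delta>])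
    show "d i \<le> d j" if "1 \<le> i" "i \<le> j" for i j using that(2) by (rule d_mono)
    show "0 < d i" if "1 \<le> i" for i using that by (rule d_pos)
    show "0 < \<delta>" by (rule \<delta>(1))
  qed (rule that)
  have "\<exists>J. finite J \<and> J \<subseteq> I \<and> d (n j) / (1 + \<delta>) < (\<Sum>p\<in>J. mode_weight s (n j) p)" for j
  proof -
    have "d (n j) / (1 + \<delta>) < d (n j)" using d_pos[OF n] \<delta> by (simp add: divide_less_eq)
    then show ?thesis using effective_dimension_finite_approx[OF s, of "d (n j) / (1 + \<delta>)" "n j"]
      unfolding d_def by metis
  qed
  then obtain J where J: "\<And>j. finite (J j)" "\<And>j. J j \<subseteq> I"
    and J_large: "\<And>j. d (n j) / (1 + \<delta>) < (\<Sum>p\<in>J j. mode_weight s (n j) p)" by metis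
  define W where "W j = (\<Sum>p\<in>J j. mode_weight s (n j) p)" for j
  define h where "h j = mode_energy s (J j) (n j)" for j
  have W_ge: "d (n j) / (1 + \<delta>) \<le> W j" for j using J_large[of j] unfolding W_def by simp
  have W: "0 < W j" for j
    using W_ge[of j] d_pos[OF n, of j] \<delta> by (smt (verit) divide_pos_pos)
  have h_le_W: "(\<integral>y. h j y \<partial>\<nu>) \<le> W j" for j
    unfolding h_def W_def by (rule integral_mode_energy_le[OF s J(2)])
  have h_nonneg: "0 \<le> (\<integral>y. h j y \<partial>\<nu>)" for j
    unfolding h_def by (intro Bochner_Integration.integral_nonneg mode_energy_bounds[OF s J])
  \<comment> \<open>The energy is bounded by \<open>n j * b / s\<close>, its mean by \<open>W j\<close>, and the tolerated deviation is \<open>\<delta> * W j\<close>; one factor \<open>W j\<close> is left in the denominator.\<close>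
  have "summable (\<lambda>j. real (n j) * b / s * (\<integral>y. h j y \<partial>\<nu>) / (real (m j) * (\<delta> * W j)\<^sup>2))"
  proof (rule summable_comparison_test')
    show "summable (\<lambda>j. b * (1 + \<delta>) / (s * \<delta>\<^sup>2) * (real (n j) / (real (m j) * d (n j))))"
      by (intro summable_mult summable_nm)
    fix j :: nat
    have m: "0 < real (m j)" using n[of j] nm[of j] by simp
    have "real (n j) * b / s * (\<integral>y. h j y \<partial>\<nu>) / (real (m j) * (\<delta> * W j)\<^sup>2)
        \<le> real (n j) * b / s * W j / (real (m j) * (\<delta> * W j)\<^sup>2)"
      using h_le_W[of j] bound_nonneg s m
      by (intro divide_right_mono mult_left_mono) auto
    also have "\<dots> = (b / (s * \<delta>\<^sup>2) * real (n j) / real (m j)) * (1 / W j)"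
      using W[of j] by (simp add: power2_eq_square ac_simps)
    also have "\<dots> \<le> (b / (s * \<delta>\<^sup>2) * real (n j) / real (m j)) * (1 / (d (n j) / (1 + \<delta>)))"
      using W_ge[of j] W[of j] d_pos[OF n, of j] \<delta> bound_nonneg s m
      by (intro mult_left_mono divide_left_mono mult_pos_pos) auto
    also have "\<dots> = b * (1 + \<delta>) / (s * \<delta>\<^sup>2) * (real (n j) / (real (m j) * d (n j)))"
      by (simp add: ac_simps)
    finally show "norm (real (n j) * b / s * (\<integral>y. h j y \<partial>\<nu>) / (real (m j) * (\<delta> * W j)\<^sup>2))
        \<le> b * (1 + \<delta>) / (s * \<delta>\<^sup>2) * (real (n j) / (real (m j) * d (n j)))"
      using h_nonneg[of j] bound_nonneg s m by (subst real_norm_def, subst abs_of_nonneg) auto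
  qed
  then have "AE \<omega> in P. \<forall>\<^sub>F j in sequentially. \<forall>N\<ge>m j.
      (\<Sum>i<N. h j (x i \<omega>)) \<le> (1 + \<delta>) * real N * ((\<integral>y. h j y \<partial>\<nu>) + \<delta> * W j)"
  proof (intro P.AE_eventually_averages_le[OF indep distr, where K = "\<lambda>j. real (n j) * b / s"])
    show "h j \<in> borel_measurable \<nu>" for j
      unfolding h_def by (rule mode_energy_measurable[OF s J(2)])
    show "0 \<le> h j y" "h j y \<le> real (n j) * b / s" for j y
      unfolding h_def by (rule mode_energy_bounds[OF s J])+
    show "0 < m j" for j using n[of j] nm[of j] by simp
  qed (use W \<delta> in auto)
  with noise show ?thesis
  proof eventually_elim
    case (elim \<omega>)
    then obtain K where K: "\<And>j N. \<lbrakk>K \<le> j; m j \<le> N\<rbrakk> \<Longrightarrow>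
        (\<Sum>i<N. h j (x i \<omega>)) \<le> (1 + \<delta>) * real N * ((\<integral>y. h j y \<partial>\<nu>) + \<delta> * W j)"
      unfolding eventually_sequentially by blast
    show ?case
      using cover[of K]
    proof eventually_elim
      case (elim N)
      then obtain j where j: "K \<le> j" "m j \<le> N" "d N \<le> (1 + \<delta>) * d (n j)" by blast
      have nN: "n j \<le> N" using nm[of j] j(2) by simp
      then have N: "1 \<le> N" using n[of j] by simp
      define T where "T = (\<Sum>p\<in>J j. lam p / (s + lam p * (\<Sum>i<N. (\<phi> p (x i \<omega>))\<^sup>2)))"
      define L where "L = (\<Sum>\<^sub>\<infinity>p\<in>I. lam p / (s + real N * lam p))"
      \<comment> \<open>Up to the factor \<open>s / N\<close>, the effective dimension is the claimed lower bound.\<close>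
      have dN: "d N = real N * L"
        unfolding d_def L_def effective_dimension_def mode_weight_def
        by (subst infsum_cmult_right'[symmetric]) simp
      have "W j / (1 + \<delta>)\<^sup>2 \<le> real N * T"
        using mode_sum_ge[OF s J(2) n nN \<delta>(1), where X = "\<lambda>i. x i \<omega>"] K[OF j(1,2)]
        unfolding W_def h_def T_def by blast
      moreover have "d N / (1 + \<delta>) ^ 4 \<le> W j / (1 + \<delta>)\<^sup>2"
      proof -
        have "d N \<le> (1 + \<delta>) * ((1 + \<delta>) * W j)"
          using j(3) W_ge[of j] \<delta> by (smt (verit) mult_left_mono pos_divide_le_eq mult.commute)
        then have "d N / (1 + \<delta>) ^ 4 \<le> ((1 + \<delta>) * ((1 + \<delta>) * W j)) / (1 + \<delta>) ^ 4"
          using \<delta> by (intro divide_right_mono) auto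
        also have "\<dots> = W j / (1 + \<delta>)\<^sup>2" using \<delta> by (simp add: power4_eq_xxxx power2_eq_square)
        finally show ?thesis .
      qed
      moreover have "(1 - \<epsilon>) * d N < d N / (1 + \<delta>) ^ 4"
        using mult_strict_right_mono[OF loss d_pos[OF N]] by simp
      ultimately have "real N * ((1 - \<epsilon>) * L) < real N * T" unfolding dN by (simp add: ac_simps)
      then have "(1 - \<epsilon>) * L < T" using N by simp
      then have "(1 - \<epsilon>) * (s * L) < s * T" using mult_strict_left_mono[OF _ s] by (metis mult.left_commute)
      also have "s * T = (\<Sum>p\<in>J j. s * lam p / (s + lam p * (\<Sum>i<N. (\<phi> p (x i \<omega>))\<^sup>2)))"
        unfolding T_def sum_distrib_left by simp
      also have "\<dots> \<le> (\<integral>y. posterior_variance k r M N (\<lambda>i. x i \<omega>) y \<partial>\<nu>)"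
        using \<open>\<forall>i. s \<le> r (x i \<omega>) / real M\<close> by (intro integral_posterior_variance_ge s J) auto
      finally show ?case unfolding L_def .
    qed
  qed
qed

end

section \<open>Kernels on the support of a measure\<close>

context bounded_mercer_kernel
begin

text \<open>
  Outside \<open>S\<close> the posterior variance of the extended kernel vanishes, since the vector of its
  values at the observation points does. The integral over the whole space is therefore the
  integral over \<open>S\<close>.
\<close>

lemma IMSE_zero_extension:
  fixes g :: "'a \<Rightarrow> 'a \<Rightarrow> real"
  assumes zero_ext: "\<And>y z. k y z = indicator S y * indicator S z * g y z"
    and X: "\<And>i. i < N \<Longrightarrow> X i \<in> S"
    and noise: "\<And>i. i < N \<Longrightarrow> s \<le> r (X i) / real M" and s: "0 < s"
  shows "IMSE \<nu> S g r M N X = (\<integral>y. posterior_variance k r M N X y \<partial>\<nu>)"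
proof -
  obtain B where B: "\<And>y. posterior_variance k r M N X y
      = k y y - (\<Sum>i<N. \<Sum>j<N. B i j * k (X i) y * k (X j) y)"
  proof (rule posterior_variance_quadratic_form[where N = N and k = k and X = X and s = s and r = r and M = M])
    show "0 \<le> (\<Sum>i<N. \<Sum>j<N. z i * z j * k (X i) (X j))" for z by (rule gram_form_nonneg)
    show "s \<le> r (X i) / real M" if "i < N" for i using that by (rule noise)
    show "0 < s" by (rule s)
  qed (rule that)
  have gram: "gram_matrix g N X = gram_matrix k N X"
    unfolding gram_matrix_def zero_ext using X by (intro cong_mat) auto
  have vec: "kernel_vector g N X y = kernel_vector k N X y" if "y \<in> S" for y
    unfolding kernel_vector_def zero_ext using X that by (intro eq_vecI) auto
  have "indicator S y *\<^sub>R posterior_variance g r M N X y = posterior_variance k r M N X y" for y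
  proof (cases "y \<in> S")
    case True
    then have "g y y = k y y" unfolding zero_ext by simp
    then show ?thesis using True unfolding posterior_variance_def gram vec[OF True] by simp
  next
    case False
    then have "k z y = 0" for z unfolding zero_ext by simp
    then show ?thesis using False unfolding B by simp
  qed
  then show ?thesis unfolding IMSE_def set_lebesgue_integral_def by simp
qed

end

lemma closed_support_of: "closed (support_of \<nu>)"
proof -
  have "- support_of \<nu> = \<Union> {U. open U \<and> emeasure \<nu> U = 0}"
    unfolding support_of_def by auto
  then have "open (- support_of \<nu>)" by (auto intro: open_Union)
  then show ?thesis by (simp add: closed_def)
qed

text \<open>
  Second countability makes the complement of the support a countable union of basic open null
  sets.
\<close>

lemma AE_in_support_of:
  fixes \<nu> :: "'a::second_countable_topology measure"
  assumes sets: "sets \<nu> = sets borel"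
  shows "AE y in \<nu>. y \<in> support_of \<nu>"
proof -
  obtain B :: "'a set set" where B: "countable B" "topological_basis B"
    using ex_countable_basis by blast
  have "(\<Union>U\<in>{U \<in> B. emeasure \<nu> U = 0}. U) \<in> null_sets \<nu>"
  proof (rule null_sets_UN')
    show "countable {U \<in> B. emeasure \<nu> U = 0}" using B(1) by (rule countable_subset[rotated]) auto
    show "U \<in> null_sets \<nu>" if "U \<in> {U \<in> B. emeasure \<nu> U = 0}" for U
      using that topological_basis_open[OF B(2), of U] sets by (auto simp: null_sets_def)
  qed
  then show ?thesis
  proof (rule AE_I')
    show "{y \<in> space \<nu>. y \<notin> support_of \<nu>} \<subseteq> (\<Union>U\<in>{U \<in> B. emeasure \<nu> U = 0}. U)"
    proof
      fix y assume "y \<in> {y \<in> space \<nu>. y \<notin> support_of \<nu>}"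
      then obtain U where U: "open U" "y \<in> U" "emeasure \<nu> U = 0"
        unfolding support_of_def by auto
      then obtain V where V: "V \<in> B" "y \<in> V" "V \<subseteq> U"
        using B(2) by (meson topological_basisE)
      have "emeasure \<nu> V \<le> emeasure \<nu> U"
        using V U(1) sets by (intro emeasure_mono) auto
      then show "y \<in> (\<Union>U\<in>{U \<in> B. emeasure \<nu> U = 0}. U)" using U(3) V by auto
    qed
  qed
qed


lemma indep_vars_cong_sets:
  assumes "prob_space P" "sets A = sets B"
  shows "prob_space.indep_vars P (\<lambda>_. A) x J \<longleftrightarrow> prob_space.indep_vars P (\<lambda>_. B) x J"
  unfolding prob_space.indep_vars_def[OF assms(1)] assms(2) measurable_cong_sets[OF refl assms(2)] ..

lemma bounded_mercer_kernel_zero_extension: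
  assumes "prob_space \<nu>" and eig: "positive_eigensystem \<nu> S k I lam \<phi>"
    and mercer: "mercer_expansion S k I lam \<phi>" and bounded: "\<forall>y\<in>S. \<forall>y'\<in>S. \<bar>k y y'\<bar> \<le> b"
  shows "bounded_mercer_kernel \<nu> (\<lambda>y z. indicator S y * indicator S z * k y z) I lam
           (\<lambda>i y. indicator S y * \<phi> i y) \<bar>b\<bar>"
proof -
  interpret prob_space \<nu> by fact
  have L2: "\<phi> i \<in> L2_on \<nu> S" if "i \<in> I" for i
    using eig that unfolding positive_eigensystem_def eigenfunction_for_def by auto
  show ?thesis
  proof
    fix i j assume i: "i \<in> I"
    show "0 < lam i" using eig i unfolding positive_eigensystem_def by auto
    show "(\<lambda>y. indicator S y * \<phi> i y) \<in> borel_measurable \<nu>"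
      using L2[OF i] unfolding L2_on_def set_borel_measurable_def by simp
    have "(indicator S y * \<phi> i y)\<^sup>2 = indicator S y * (\<phi> i y)\<^sup>2" for y
      by (auto simp: indicator_def)
    then show "integrable \<nu> (\<lambda>y. (indicator S y * \<phi> i y)\<^sup>2)"
      using L2[OF i] unfolding L2_on_def set_integrable_def by simp
    assume j: "j \<in> I"
    have "(LINT y:S|\<nu>. \<phi> i y * \<phi> j y) = (if i = j then 1 else 0)"
      using eig i j unfolding positive_eigensystem_def by blast
    moreover have "indicator S y *\<^sub>R (\<phi> i y * \<phi> j y) = indicator S y * \<phi> i y * (indicator S y * \<phi> j y)" for y
      by (auto simp: indicator_def)
    ultimately show "(\<integral>y. indicator S y * \<phi> i y * (indicator S y * \<phi> j y) \<partial>\<nu>) = (if i = j then 1 else 0)"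
      unfolding set_lebesgue_integral_def by (simp only:)
  next
    fix y z
    show "((\<lambda>i. lam i * (indicator S y * \<phi> i y) * (indicator S z * \<phi> i z)) has_sum
        indicator S y * indicator S z * k y z) I"
      using mercer unfolding mercer_expansion_def by (cases "y \<in> S"; cases "z \<in> S") auto
    show "indicator S y * indicator S y * k y y \<le> \<bar>b\<bar>"
    proof (cases "y \<in> S")
      case True
      then have "\<bar>k y y\<bar> \<le> b" using bounded by blast
      then show ?thesis using True by simp
    qed simp
  qed
qed

theorem theorem1:
  fixes T L :: real
    and a :: "real \<Rightarrow> real ^ 'd \<Rightarrow> real ^ 'm ^ 'd"
    and b :: "real \<Rightarrow> real ^ 'd \<Rightarrow> real ^ 'd"
    and c h v :: "real \<Rightarrow> real ^ 'd \<Rightarrow> real"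
    and g :: "real ^ 'd \<Rightarrow> real"
    and \<X> :: "(real ^ 'd) set"
    and \<nu> :: "(real ^ 'd) measure"
    and k :: "real ^ 'd \<Rightarrow> real ^ 'd \<Rightarrow> real"
    and H :: "(real ^ 'd \<Rightarrow> real) set"
    and ip :: "(real ^ 'd \<Rightarrow> real) \<Rightarrow> (real ^ 'd \<Rightarrow> real) \<Rightarrow> real"
    and I :: "nat set"
    and lam :: "nat \<Rightarrow> real"
    and \<phi> :: "nat \<Rightarrow> real ^ 'd \<Rightarrow> real"
    and r :: "real ^ 'd \<Rightarrow> real"
    and rmin :: real
    and M :: nat
    and P :: "'w measure"
    and x :: "nat \<Rightarrow> 'w \<Rightarrow> real ^ 'd"
    and \<xi> u :: "nat \<Rightarrow> nat \<Rightarrow> 'w \<Rightarrow> real"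
    and U :: "nat \<Rightarrow> 'w \<Rightarrow> real"
  assumes "T > 0" and "L > 0"
    and "regular_coefficient T L a" and "regular_coefficient T L b"
    and "regular_coefficient T L c" and "regular_coefficient T L h"
    and "\<exists>C. \<forall>t\<in>{0..T}. \<forall>y. \<bar>c t y\<bar> \<le> C"
    and "viscosity_solution T a b c h g v"
    and "prob_space \<nu>" and "sets \<nu> = sets borel" and "support_of \<nu> = \<X>"
    and "\<forall>y\<in>\<X>. \<forall>y'\<in>\<X>. k y y' = k y' y"
    and "\<exists>B. \<forall>y\<in>\<X>. \<forall>y'\<in>\<X>. \<bar>k y y'\<bar> \<le> B"
    and "positive_definite_on \<X> k"
    and "reproducing_kernel_hilbert_space \<X> k H ip"
    and "eigenvalue_index_set \<X> H I" and "I \<noteq> {}"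
    and "positive_eigensystem \<nu> \<X> k I lam \<phi>"
    and "mercer_expansion \<X> k I lam \<phi>"
    and "\<forall>y\<in>\<X>. 0 \<le> r y" and "set_borel_measurable borel \<X> r"
    and "M \<ge> 1"
    and "prob_space P"
    and "prob_space.indep_vars P (\<lambda>_. borel) x UNIV" and "\<forall>i. distr P borel (x i) = \<nu>"
    and "\<forall>i. \<forall>j<M. \<xi> i j \<in> borel_measurable P"
    and "\<forall>N. gaussian_noise P \<nu> r M x \<xi> N"
    and "\<forall>i. \<forall>j<M. \<forall>\<omega>\<in>space P. u i j \<omega> = v 0 (x i \<omega>) + \<xi> i j \<omega>"
    and "\<forall>i. \<forall>\<omega>\<in>space P. U i \<omega> = sample_mean M u i \<omega>"
    and "\<forall>N. gaussian_data P \<nu> r M (v 0) x U N"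
    and "\<exists>y0\<in>\<X>. r y0 = rmin" and "\<forall>y\<in>\<X>. rmin \<le> r y" and "rmin > 0"
  shows "\<forall>\<epsilon>>0. AE \<omega> in P. \<exists>Nt::nat. Nt > 0 \<and>
           (\<forall>N>Nt. IMSE \<nu> \<X> k r M N (\<lambda>i. x i \<omega>) > (1 - \<epsilon>) * L_IMSE rmin M I lam N)"
proof (intro allI impI)
  fix \<epsilon> :: real assume \<epsilon>: "0 < \<epsilon>"
  define s where "s = rmin / real M"
  have s: "0 < s" using \<open>rmin > 0\<close> \<open>M \<ge> 1\<close> unfolding s_def by simp
  obtain b where b: "\<forall>y\<in>\<X>. \<forall>y'\<in>\<X>. \<bar>k y y'\<bar> \<le> b" using assms by blast
  interpret bounded_mercer_kernel \<nu> "\<lambda>y z. indicator \<X> y * indicator \<X> z * k y z" I lam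
      "\<lambda>i y. indicator \<X> y * \<phi> i y" "\<bar>b\<bar>"
    by (rule bounded_mercer_kernel_zero_extension) (fact assms b)+
  have x_measurable: "x i \<in> P \<rightarrow>\<^sub>M borel" for i
    using \<open>prob_space.indep_vars P (\<lambda>_. borel) x UNIV\<close>
    unfolding prob_space.indep_vars_def[OF \<open>prob_space P\<close>] by simp
  have distr: "distr P \<nu> (x i) = \<nu>" for i
    using \<open>\<forall>i. distr P borel (x i) = \<nu>\<close> distr_cong[OF refl \<open>sets \<nu> = sets borel\<close>, of P "x i" "x i"]
    by simp
  have "AE \<omega> in P. x i \<omega> \<in> \<X>" for i
  proof -
    have "AE y in distr P borel (x i). y \<in> \<X>"
      using AE_in_support_of[OF \<open>sets \<nu> = sets borel\<close>]
      unfolding \<open>support_of \<nu> = \<X>\<close> \<open>\<forall>i. distr P borel (x i) = \<nu>\<close>[rule_format] .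
    then show ?thesis
      using x_measurable borel_closed[OF closed_support_of, of \<nu>] \<open>support_of \<nu> = \<X>\<close>
      by (subst (asm) AE_distr_iff) auto
  qed
  then have in_support: "AE \<omega> in P. \<forall>i. x i \<omega> \<in> \<X>" by (simp add: AE_all_countable)
  have noise: "s \<le> r y / real M" if "y \<in> \<X>" for y
    using that \<open>\<forall>y\<in>\<X>. rmin \<le> r y\<close> unfolding s_def by (simp add: divide_right_mono)
  have L: "L_IMSE rmin M I lam N = s * (\<Sum>\<^sub>\<infinity>p\<in>I. lam p / (s + real N * lam p))" for N
  proof -
    have "rmin * (lam p / (rmin + real N * real M * lam p)) = s * (lam p / (s + real N * lam p))" for p
    proof -
      have "s + real N * lam p = (rmin + real N * real M * lam p) / real M"
        using \<open>M \<ge> 1\<close> unfolding s_def by (simp add: add_divide_distrib)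
      then show ?thesis using \<open>M \<ge> 1\<close> unfolding s_def by simp
    qed
    then show ?thesis unfolding L_IMSE_def infsum_cmult_right'[symmetric] by simp
  qed
  have "AE \<omega> in P. \<forall>i. s \<le> r (x i \<omega>) / real M"
    using in_support by eventually_elim (auto intro: noise)
  then have "AE \<omega> in P. \<forall>\<^sub>F N in sequentially.
      (1 - \<epsilon>) * (s * (\<Sum>\<^sub>\<infinity>p\<in>I. lam p / (s + real N * lam p)))
        < (\<integral>y. posterior_variance (\<lambda>y z. indicator \<X> y * indicator \<X> z * k y z) r M N (\<lambda>i. x i \<omega>) y \<partial>\<nu>)"
    using \<open>prob_space.indep_vars P (\<lambda>_. borel) x UNIV\<close>
      indep_vars_cong_sets[OF \<open>prob_space P\<close> \<open>sets \<nu> = sets borel\<close>, of x UNIV]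
    by (intro AE_eventually_integral_posterior_variance_gt[OF \<open>prob_space P\<close> _ distr _ s \<open>I \<noteq> {}\<close> \<epsilon>])
       (simp only:)
  with in_support show "AE \<omega> in P. \<exists>Nt::nat. Nt > 0 \<and>
      (\<forall>N>Nt. IMSE \<nu> \<X> k r M N (\<lambda>i. x i \<omega>) > (1 - \<epsilon>) * L_IMSE rmin M I lam N)"
  proof eventually_elim
    case (elim \<omega>)
    have "IMSE \<nu> \<X> k r M N (\<lambda>i. x i \<omega>)
        = (\<integral>y. posterior_variance (\<lambda>y z. indicator \<X> y * indicator \<X> z * k y z) r M N (\<lambda>i. x i \<omega>) y \<partial>\<nu>)" for N
      using elim(1) noise by (intro IMSE_zero_extension[OF refl _ _ s]) auto
    then obtain N0 where N0: "\<And>N. N0 \<le> N \<Longrightarrow>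
        (1 - \<epsilon>) * L_IMSE rmin M I lam N < IMSE \<nu> \<X> k r M N (\<lambda>i. x i \<omega>)"
      using elim(2) unfolding L eventually_sequentially by auto
    show ?case by (intro exI[of _ "Suc N0"]) (auto intro: N0)
  qed
qed

end
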